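(* Let $T>0$ and let $X=\{X(t)\}_{t\ge0}$ be the generalized fractional Brownian motion with parameters $\gamma\in[0,1)$ and $\alpha\in\big(-\tfrac12+\tfrac{\gamma}{2},\,\tfrac12+\tfrac{\gamma}{2}\big)$, and let $H=\alpha-\tfrac{\gamma}{2}+\tfrac12$. If $\alpha>0$, then with probability one, $$\limsup_{u\to0^+}\frac{|X(ut)|}{u^{H}\sqrt{\log\log u^{-1}}}$$ exists for all $t\in(0,T]$.
   Context: Let $B(\mathrm{d}u)$ be a Gaussian random measure on $\mathbb{R}$ with Lebesgue control measure $\mathrm{d}u$ (equivalently, the white noise of a two-sided standard Brownian motion $B$). For $\gamma\in[0,1)$ and $\alpha\in(-\frac12+\frac{\gamma}{2},\frac12+\frac{\gamma}{2})$, the generalized fractional Brownian motion (GFBM) is the mean-zero Gaussian process with continuous sample paths given (in distribution, as a process) by $$X(t)= c\int_{\mathbb{R}}\big((t-u)_+^{\alpha}-(-u)_+^{\alpha}\big)\,|u|^{-\gamma/2}\,B(\mathrm{d}u),\qquad t\ge 0,$$ where $x_+^{\alpha}=x^{\alpha}$ if $x>0$ and $x_+^{\alpha}=0$ otherwise, and $c=c(\alpha,\gamma)>0$ is the normalization constant for which $\mathrm{Var}(X(t))=t^{2H}$ for all $t\ge0$, that is, $c^{-2}=\int_0^1(1-v)^{2\alpha}v^{-\gamma}\,\mathrm{d}v+\int_0^\infty[(1+v)^{\alpha}-v^{\alpha}]^2v^{-\gamma}\,\mathrm{d}v$. The process is self-similar with Hurst parameter $H=\alpha-\frac{\gamma}{2}+\frac12\in(0,1)$.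 *)

theory Defs
  imports "HOL-Probability.Probability"
begin

text \<open>A Gaussian random measure \<open>W\<close> on the probability space \<open>N\<close> with control measure \<open>m\<close>.
  Only the values of \<open>W\<close> on measurable sets of finite control measure are meaningful.\<close>

locale gaussian_random_measure = prob_space N
  for N :: "'b measure" and m :: "'s measure" and W :: "'s set \<Rightarrow> 'b \<Rightarrow> real" +
  assumes measurable_W:
    "\<And>A. A \<in> sets m \<Longrightarrow> emeasure m A < \<infinity> \<Longrightarrow> random_variable borel (W A)"
  and normal_W:
    "\<And>A. A \<in> sets m \<Longrightarrow> emeasure m A < \<infinity> \<Longrightarrow> measure m A > 0 \<Longrightarrow>
       distributed N lborel (W A) (normal_density 0 (sqrt (measure m A)))"
  and null_W:
    "\<And>A. A \<in> sets m \<Longrightarrow> emeasure m A = 0 \<Longrightarrow> AE \<omega> in N. W A \<omega> = 0"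
  and independently_scattered:
    "\<And>(A :: nat \<Rightarrow> 's set) I. finite I \<Longrightarrow> disjoint_family_on A I \<Longrightarrow>
       (\<And>i. i \<in> I \<Longrightarrow> A i \<in> sets m \<and> emeasure m (A i) < \<infinity>) \<Longrightarrow>
       indep_vars (\<lambda>_. borel) (\<lambda>i. W (A i)) I"
  and countably_additive_W:
    "\<And>A :: nat \<Rightarrow> 's set. disjoint_family A \<Longrightarrow> range A \<subseteq> sets m \<Longrightarrow>
       emeasure m (\<Union>i. A i) < \<infinity> \<Longrightarrow>
       AE \<omega> in N. (\<lambda>i. W (A i) \<omega>) sums W (\<Union>i. A i) \<omega>"

text \<open>The analogue of \<^const>\<open>Bochner_Integration.simple_bochner_integral\<close>. The level set of the value \<open>0\<close> may have
  infinite control measure, but its contribution is multiplied by \<open>0\<close>.\<close>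

definition elementary_wiener_integral ::
    "'s measure \<Rightarrow> ('s set \<Rightarrow> 'b \<Rightarrow> real) \<Rightarrow> ('s \<Rightarrow> real) \<Rightarrow> 'b \<Rightarrow> real" where
  "elementary_wiener_integral m W s \<omega> =
     (\<Sum>y \<in> s ` space m. y * W {x \<in> space m. s x = y} \<omega>)"

text \<open>\<open>Y\<close> is a version of the integral of \<open>f\<close> with respect to \<open>W\<close>: the limit in mean square
  of elementary integrals of simple functions that converge to \<open>f\<close> in mean square. It is a
  relation because \<open>Y\<close> is determined by \<open>f\<close> only almost surely.\<close>

definition has_wiener_integral ::
    "'b measure \<Rightarrow> 's measure \<Rightarrow> ('s set \<Rightarrow> 'b \<Rightarrow> real) \<Rightarrow> ('s \<Rightarrow> real) \<Rightarrow> ('b \<Rightarrow> real) \<Rightarrow> bool"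
  where
  "has_wiener_integral N m W f Y \<longleftrightarrow>
     f \<in> borel_measurable m \<and> Y \<in> borel_measurable N \<and>
     (\<exists>s. (\<forall>n. Bochner_Integration.simple_bochner_integrable m (s n)) \<and>
        (\<lambda>n. \<integral>\<^sup>+ x. ennreal ((s n x - f x)\<^sup>2) \<partial>m) \<longlonglongrightarrow> 0 \<and>
        (\<lambda>n. \<integral>\<^sup>+ \<omega>. ennreal ((elementary_wiener_integral m W (s n) \<omega> - Y \<omega>)\<^sup>2) \<partial>N) \<longlonglongrightarrow> 0)"

definition pos_powr :: "real \<Rightarrow> real \<Rightarrow> real" where
  "pos_powr x a = (if x > 0 then x powr a else 0)"

text \<open>Since \<open>0 powr a = 0\<close>, the kernel vanishes at \<open>u = 0\<close>; this is a Lebesgue null set.\<close>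

definition gfbm_kernel :: "real \<Rightarrow> real \<Rightarrow> real \<Rightarrow> real \<Rightarrow> real" where
  "gfbm_kernel \<alpha> \<gamma> t u =
     (pos_powr (t - u) \<alpha> - pos_powr (- u) \<alpha>) * \<bar>u\<bar> powr (- \<gamma> / 2)"

definition gfbm_const :: "real \<Rightarrow> real \<Rightarrow> real" where
  "gfbm_const \<alpha> \<gamma> = 1 / sqrt (
     (LINT v:{0<..<1}|lborel. (1 - v) powr (2 * \<alpha>) * v powr (- \<gamma>)) +
     (LINT v:{0<..}|lborel. ((1 + v) powr \<alpha> - v powr \<alpha>)\<^sup>2 * v powr (- \<gamma>)))"

definition process_law :: "'a measure \<Rightarrow> (real \<Rightarrow> 'a \<Rightarrow> real) \<Rightarrow> (real \<Rightarrow> real) measure" where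
  "process_law M X = distr M (\<Pi>\<^sub>M t\<in>{0..}. borel) (\<lambda>\<omega>. \<lambda>t\<in>{0..}. X t \<omega>)"

text \<open>The representation by the Gaussian random measure \<open>W\<close> holds in distribution, so \<open>W\<close> may
  live on another probability space \<open>N\<close> than the process \<open>X\<close>. That \<open>X\<close> is a mean-zero Gaussian
  process is a consequence of the representation.\<close>

definition is_gfbm ::
    "real \<Rightarrow> real \<Rightarrow> 'a measure \<Rightarrow> (real \<Rightarrow> 'a \<Rightarrow> real) \<Rightarrow>
     'b measure \<Rightarrow> (real set \<Rightarrow> 'b \<Rightarrow> real) \<Rightarrow> bool" where
  "is_gfbm \<alpha> \<gamma> M X N W \<longleftrightarrow>
     prob_space M \<and> gaussian_random_measure N lborel W \<and>
     (\<forall>t\<ge>0. X t \<in> borel_measurable M) \<and>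
     (\<forall>\<omega>\<in>space M. continuous_on {0..} (\<lambda>t. X t \<omega>)) \<and>
     (\<exists>I. (\<forall>t\<ge>0. has_wiener_integral N lborel W (gfbm_kernel \<alpha> \<gamma> t) (I t)) \<and>
        process_law M X = process_law N (\<lambda>t \<omega>. gfbm_const \<alpha> \<gamma> * I t \<omega>))"

end

theory Submission imports Defs begin

text \<open>For \<open>0 \<le> s < t \<le> R\<close> the kernels of \<open>X s\<close> and \<open>X t\<close> have squared distance at most
  \<open>C * (t - s) powr (2 * \<alpha>) * R powr (1 - \<gamma>)\<close>, so increments of \<open>X\<close> have Gaussian tails of that
  scale. Dyadic chaining on \<open>[0, exp (- n)]\<close> and the Borel--Cantelli lemma give
  \<open>\<bar>X s\<bar> \<le> K * exp (- n) powr H * sqrt (ln n)\<close> there for all large \<open>n\<close>, almost surely, that is, the upper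
  half of the law of the iterated logarithm up to a constant. Hence the upper limit at \<open>t = 1\<close> is finite,
  and rescaling \<open>s = u * t\<close> transports the bound to all \<open>t\<close> on the same event.\<close>

section \<open>Gaussian tails of Wiener integrals\<close>

text \<open>The increments of \<open>X\<close> are not stationary: the weight
  \<open>\<bar>u\<bar> powr (- \<gamma> / 2)\<close> is singular at the origin, exactly where the
  upper limit is taken. This is why the variance bound carries the right end point \<open>R\<close>
  beside the lag. With lag \<open>R / 2 ^ j\<close> it bounds the standard deviation by a constant
  times \<open>R powr H * 2 powr (- \<alpha> * j)\<close>, because \<alpha> + (1 - \<gamma>) / 2 =
  H; positivity of \<alpha> then makes the chaining sum converge, and the power of \<open>R\<close>
  is the one in the denominator. Exponential blocks are chosen because the iterated logarithm of
  \<open>1 / u\<close> becomes \<open>ln n\<close> on them. The representation holds only in law, so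
  single probabilities are all that passes from the integrals to \<open>X\<close>, whereas
  continuity belongs to the paths of \<open>X\<close>. Tails are therefore proved for the integrals,
  moved to \<open>X\<close>, and only then chained. The Gaussian input is reduced to exponential
  moments, which multiply over disjoint sets.\<close>

lemma nn_integral_normal_density_exp:
  assumes "\<sigma> > 0"
  shows "(\<integral>\<^sup>+ x. ennreal (normal_density 0 \<sigma> x) * ennreal (exp (l * x)) \<partial>lborel) = ennreal (exp (l\<^sup>2 * \<sigma>\<^sup>2 / 2))"
proof -
  \<comment> \<open>Completing the square: tilting by \<open>exp (l * x)\<close> shifts the mean to
    \<open>l * \<sigma>\<^sup>2\<close> and leaves a constant times a probability density.\<close>
  have eq: "normal_density 0 \<sigma> x * exp (l * x) = exp (l\<^sup>2 * \<sigma>\<^sup>2 / 2) * normal_density (l * \<sigma>\<^sup>2) \<sigma> x" for x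
  proof -
    have "- x\<^sup>2 / (2 * \<sigma>\<^sup>2) + l * x = l\<^sup>2 * \<sigma>\<^sup>2 / 2 + - (x - l * \<sigma>\<^sup>2)\<^sup>2 / (2 * \<sigma>\<^sup>2)"
      using assms by (simp add: field_simps power2_eq_square)
    then have "exp (- x\<^sup>2 / (2 * \<sigma>\<^sup>2)) * exp (l * x) = exp (l\<^sup>2 * \<sigma>\<^sup>2 / 2) * exp (- (x - l * \<sigma>\<^sup>2)\<^sup>2 / (2 * \<sigma>\<^sup>2))"
      by (simp only: exp_add [symmetric])
    then show ?thesis
      by (simp add: normal_density_def)
  qed
  interpret P: prob_space "density lborel (normal_density (l * \<sigma>\<^sup>2) \<sigma>)"
    using assms by (rule prob_space_normal_density)
  have 1: "(\<integral>\<^sup>+ x. ennreal (normal_density (l * \<sigma>\<^sup>2) \<sigma> x) \<partial>lborel) = 1"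
    using P.emeasure_space_1 by (simp add: emeasure_density)
  have "(\<integral>\<^sup>+ x. ennreal (normal_density 0 \<sigma> x) * ennreal (exp (l * x)) \<partial>lborel)
      = (\<integral>\<^sup>+ x. ennreal (exp (l\<^sup>2 * \<sigma>\<^sup>2 / 2)) * ennreal (normal_density (l * \<sigma>\<^sup>2) \<sigma> x) \<partial>lborel)"
    by (intro nn_integral_cong) (simp add: ennreal_mult [symmetric] eq)
  also have "\<dots> = ennreal (exp (l\<^sup>2 * \<sigma>\<^sup>2 / 2))"
    by (simp add: nn_integral_cmult 1)
  finally show ?thesis .
qed

context gaussian_random_measure
begin

lemma nn_integral_exp_W:
  assumes A: "A \<in> sets m" "emeasure m A < \<infinity>"
  shows "(\<integral>\<^sup>+ \<omega>. ennreal (exp (l * W A \<omega>)) \<partial>N) = ennreal (exp (l\<^sup>2 * measure m A / 2))"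
proof (cases "measure m A = 0")
  \<comment> \<open>A degenerate value has no normal density; here \<open>null_W\<close> makes both
    sides equal to 1.\<close>
  case True
  then have "emeasure m A = 0"
    using A by (simp add: emeasure_eq_ennreal_measure)
  then have "AE \<omega> in N. W A \<omega> = 0"
    using A null_W by blast
  then have "(\<integral>\<^sup>+ \<omega>. ennreal (exp (l * W A \<omega>)) \<partial>N) = (\<integral>\<^sup>+ \<omega>. 1 \<partial>N)"
    by (intro nn_integral_cong_AE) auto
  then show ?thesis
    using True by (simp add: emeasure_space_1)
next
  case False
  then have pos: "measure m A > 0"
    by (simp add: zero_less_measure_iff)
  note D = normal_W [OF A pos]
  have "(\<integral>\<^sup>+ \<omega>. ennreal (exp (l * W A \<omega>)) \<partial>N)
      = (\<integral>\<^sup>+ x. ennreal (normal_density 0 (sqrt (measure m A)) x) * ennreal (exp (l * x)) \<partial>lborel)"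
    by (rule distributed_nn_integral [OF D, symmetric]) simp
  also have "\<dots> = ennreal (exp (l\<^sup>2 * (sqrt (measure m A))\<^sup>2 / 2))"
    by (rule nn_integral_normal_density_exp) (use pos in simp)
  finally show ?thesis
    using pos by simp
qed

text \<open>Countable additivity applied to the family padded with empty sets, whose
  \<open>W\<close> value is almost surely 0 by \<open>null_W\<close>.\<close>

lemma AE_W_finite_Union:
  fixes A :: "nat \<Rightarrow> 's set"
  assumes "finite I" and disj: "disjoint_family_on A I"
    and A: "\<And>i. i \<in> I \<Longrightarrow> A i \<in> sets m \<and> emeasure m (A i) < \<infinity>"
  shows "AE \<omega> in N. W (\<Union>i\<in>I. A i) \<omega> = (\<Sum>i\<in>I. W (A i) \<omega>)"
proof -
  define B where "B i = (if i \<in> I then A i else {})" for i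
  have U: "(\<Union>i. B i) = (\<Union>i\<in>I. A i)"
    by (auto simp: B_def split: if_splits)
  have "emeasure m (\<Union>i\<in>I. A i) \<le> (\<Sum>i\<in>I. emeasure m (A i))"
    using assms by (intro emeasure_subadditive_finite) auto
  also have "\<dots> < \<infinity>"
    using A \<open>finite I\<close> by (simp add: less_top [symmetric])
  finally have fin: "emeasure m (\<Union>i. B i) < \<infinity>"
    by (simp add: U)
  have "disjoint_family B"
    using disj by (auto simp: B_def disjoint_family_on_def)
  moreover have "range B \<subseteq> sets m"
    using A by (auto simp: B_def)
  ultimately have "AE \<omega> in N. (\<lambda>i. W (B i) \<omega>) sums W (\<Union>i. B i) \<omega>"
    using fin by (rule countably_additive_W)
  moreover have "AE \<omega> in N. W {} \<omega> = 0"
    by (rule null_W) auto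
  ultimately show ?thesis
  proof eventually_elim
    case (elim \<omega>)
    have "(\<lambda>i. W (B i) \<omega>) sums (\<Sum>i\<in>I. W (B i) \<omega>)"
      by (rule sums_finite) (use \<open>finite I\<close> elim(2) in \<open>auto simp: B_def\<close>)
    then have "W (\<Union>i. B i) \<omega> = (\<Sum>i\<in>I. W (B i) \<omega>)"
      using elim(1) sums_unique2 by blast
    then show ?case
      by (simp add: U B_def)
  qed
qed

lemma nn_integral_exp_sum_W:
  fixes A :: "nat \<Rightarrow> 's set" and c :: "nat \<Rightarrow> real"
  assumes "finite I" and disj: "disjoint_family_on A I"
    and A: "\<And>i. i \<in> I \<Longrightarrow> A i \<in> sets m \<and> emeasure m (A i) < \<infinity>"
  shows "(\<integral>\<^sup>+ \<omega>. ennreal (exp (l * (\<Sum>i\<in>I. c i * W (A i) \<omega>))) \<partial>N)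
    = ennreal (exp (l\<^sup>2 * (\<Sum>i\<in>I. (c i)\<^sup>2 * measure m (A i)) / 2))"
proof -
  have ind: "indep_vars (\<lambda>_. borel) (\<lambda>i. W (A i)) I"
    using assms by (intro independently_scattered) auto
  have "(\<integral>\<^sup>+ \<omega>. ennreal (exp (l * (\<Sum>i\<in>I. c i * W (A i) \<omega>))) \<partial>N)
      = (\<integral>\<^sup>+ \<omega>. (\<Prod>i\<in>I. ennreal (exp ((l * c i) * W (A i) \<omega>))) \<partial>N)"
    using \<open>finite I\<close> by (simp add: sum_distrib_left exp_sum prod_ennreal mult.assoc)
  also have "\<dots> = (\<Prod>i\<in>I. \<integral>\<^sup>+ \<omega>. ennreal (exp ((l * c i) * W (A i) \<omega>)) \<partial>N)"
    by (intro indep_vars_nn_integral indep_vars_compose2 [OF ind] \<open>finite I\<close>) auto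
  also have "\<dots> = (\<Prod>i\<in>I. ennreal (exp ((l * c i)\<^sup>2 * measure m (A i) / 2)))"
    using A by (intro prod.cong nn_integral_exp_W) auto
  also have "\<dots> = ennreal (exp (l\<^sup>2 * (\<Sum>i\<in>I. (c i)\<^sup>2 * measure m (A i)) / 2))"
    using \<open>finite I\<close>
    by (simp add: sum_distrib_left sum_divide_distrib exp_sum prod_ennreal mult.assoc power_mult_distrib)
  finally show ?thesis .
qed

section \<open>Elementary integrals of simple functions\<close>

lemma measurable_elementary_wiener_integral:
  assumes s: "Bochner_Integration.simple_bochner_integrable m s"
  shows "random_variable borel (elementary_wiener_integral m W s)"
  unfolding elementary_wiener_integral_def [abs_def]
proof (rule borel_measurable_sum)
  fix y
  assume "y \<in> s ` space m"
  show "random_variable borel (\<lambda>\<omega>. y * W {x \<in> space m. s x = y} \<omega>)"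
  \<comment> \<open>The level set of 0 may have infinite control measure, where nothing is assumed
    about \<open>W\<close>; the factor 0 makes that term constant.\<close>
  proof (cases "y = 0")
    case False
    have sm: "s \<in> borel_measurable m"
      using s by (auto elim!: simple_bochner_integrable.cases intro: borel_measurable_simple_function)
    have "emeasure m {x \<in> space m. s x = y} \<le> emeasure m {x \<in> space m. s x \<noteq> 0}"
      using False sm by (intro emeasure_mono) auto
    also have "\<dots> < \<infinity>"
      using s by (auto elim!: simple_bochner_integrable.cases simp: less_top)
    finally have "random_variable borel (W {x \<in> space m. s x = y})"
      using sm by (intro measurable_W) auto
    then show ?thesis by simp
  qed simp
qed

text \<open>Additivity of \<open>W\<close> allows the integral to be computed over any finite
  partition finer than the nonzero level sets. Two simple functions can thus be brought to a common
  partition. Pieces on which \<open>s\<close> vanishes are allowed, since they contribute 0.\<close>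

lemma AE_elementary_wiener_integral_partition:
  fixes A :: "nat \<Rightarrow> 's set"
  assumes s: "Bochner_Integration.simple_bochner_integrable m s"
    and "finite I" and disj: "disjoint_family_on A I"
    and A: "\<And>i. i \<in> I \<Longrightarrow> A i \<in> sets m \<and> emeasure m (A i) < \<infinity>"
    and ne: "\<And>i. i \<in> I \<Longrightarrow> A i \<noteq> {}"
    and a: "\<And>i x. i \<in> I \<Longrightarrow> x \<in> A i \<Longrightarrow> s x = a i"
    and cover: "{x \<in> space m. s x \<noteq> 0} \<subseteq> (\<Union>i\<in>I. A i)"
  shows "AE \<omega> in N. elementary_wiener_integral m W s \<omega> = (\<Sum>i\<in>I. a i * W (A i) \<omega>)"
proof -
  have fin: "finite (s ` space m)"
    using s by (auto elim!: simple_bochner_integrable.cases simp: simple_function_def)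
  have sub: "A i \<subseteq> space m" if "i \<in> I" for i
    using A that sets.sets_into_space by blast
  have "AE \<omega> in N. y \<noteq> 0 \<longrightarrow> W {x \<in> space m. s x = y} \<omega> = (\<Sum>i\<in>{i\<in>I. a i = y}. W (A i) \<omega>)" for y
  proof (cases "y = 0")
    case False
    \<comment> \<open>This can fail for \<open>y = 0\<close>, whose level set may leave the union of
      the \<open>A i\<close>.\<close>
    have "{x \<in> space m. s x = y} = (\<Union>i\<in>{i\<in>I. a i = y}. A i)"
    proof (rule set_eqI, rule iffI)
      fix x assume "x \<in> {x \<in> space m. s x = y}"
      moreover from this obtain i where "i \<in> I" "x \<in> A i"
        using cover False by blast
      ultimately show "x \<in> (\<Union>i\<in>{i\<in>I. a i = y}. A i)"
        using a [of i x] by auto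
    next
      fix x assume "x \<in> (\<Union>i\<in>{i\<in>I. a i = y}. A i)"
      then show "x \<in> {x \<in> space m. s x = y}"
        using a sub by auto
    qed
    moreover have "AE \<omega> in N. W (\<Union>i\<in>{i\<in>I. a i = y}. A i) \<omega> = (\<Sum>i\<in>{i\<in>I. a i = y}. W (A i) \<omega>)"
      using \<open>finite I\<close> disj A by (intro AE_W_finite_Union) (auto simp: disjoint_family_on_def)
    ultimately show ?thesis by simp
  qed simp
  then have "AE \<omega> in N. \<forall>y\<in>s ` space m. y \<noteq> 0 \<longrightarrow>
      W {x \<in> space m. s x = y} \<omega> = (\<Sum>i\<in>{i\<in>I. a i = y}. W (A i) \<omega>)"
    by (intro AE_finite_allI fin)
  then show ?thesis
  proof eventually_elim
    case (elim \<omega>)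
    \<comment> \<open>Regrouping the sum by values with \<open>sum.group\<close> needs every
      \<open>a i\<close> to be a value of \<open>s\<close>; nonempty pieces guarantee it.\<close>
    have "a ` I \<subseteq> s ` space m"
    proof
      fix y assume "y \<in> a ` I"
      then obtain i where i: "i \<in> I" "y = a i" by auto
      obtain x where "x \<in> A i"
        using ne i by blast
      moreover from this have "x \<in> space m"
        using i sub by blast
      ultimately show "y \<in> s ` space m"
        using a [of i x] i by (metis imageI)
    qed
    have "elementary_wiener_integral m W s \<omega>
        = (\<Sum>y\<in>s ` space m. \<Sum>i\<in>{i\<in>I. a i = y}. a i * W (A i) \<omega>)"
      unfolding elementary_wiener_integral_def
    proof (rule sum.cong)
      fix y assume y: "y \<in> s ` space m"
      have "y * W {x \<in> space m. s x = y} \<omega> = y * (\<Sum>i\<in>{i\<in>I. a i = y}. W (A i) \<omega>)"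
        using elim y by (cases "y = 0") auto
      then show "y * W {x \<in> space m. s x = y} \<omega> = (\<Sum>i\<in>{i\<in>I. a i = y}. a i * W (A i) \<omega>)"
        by (simp add: sum_distrib_left)
    qed simp
    also have "\<dots> = (\<Sum>i\<in>I. a i * W (A i) \<omega>)"
      using \<open>finite I\<close> fin \<open>a ` I \<subseteq> s ` space m\<close> by (rule sum.group)
    finally show ?case .
  qed
qed

text \<open>The elementary integrals of \<open>p\<close> and \<open>q\<close> are sums over different families of level sets;
  both are rewritten over the level sets of the pair \<open>(p, q)\<close>, whose values are independent.\<close>

lemma elementary_wiener_integral_diff_moment:
  assumes p: "Bochner_Integration.simple_bochner_integrable m p" and q: "Bochner_Integration.simple_bochner_integrable m q"
  obtains v where "0 \<le> v" "(\<integral>\<^sup>+ x. ennreal ((p x - q x)\<^sup>2) \<partial>m) = ennreal v"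
    "\<And>l. (\<integral>\<^sup>+ \<omega>. ennreal (exp (l * (elementary_wiener_integral m W p \<omega>
        - elementary_wiener_integral m W q \<omega>))) \<partial>N) = ennreal (exp (l\<^sup>2 * v / 2))"
proof -
  have pq [measurable]: "p \<in> borel_measurable m" "q \<in> borel_measurable m"
    using p q by (auto elim!: simple_bochner_integrable.cases intro: borel_measurable_simple_function)
  \<comment> \<open>Without the pair (0, 0) every remaining joint level set lies in the union of the
    two supports and so has finite control measure.\<close>
  define P where "P = (\<lambda>x. (p x, q x)) ` space m - {(0, 0)}"
  have "finite ((\<lambda>x. (p x, q x)) ` space m)"
  proof (rule finite_subset)
    show "(\<lambda>x. (p x, q x)) ` space m \<subseteq> p ` space m \<times> q ` space m" by auto
    show "finite (p ` space m \<times> q ` space m)"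
      using p q by (auto elim!: simple_bochner_integrable.cases simp: simple_function_def)
  qed
  then have "finite P" by (simp add: P_def)
  \<comment> \<open>The pairs are numbered because independence and additivity of \<open>W\<close>
    are stated for families indexed by naturals.\<close>
  then obtain e where e: "bij_betw e {0..<card P} P"
    using ex_bij_betw_nat_finite by blast
  define I where "I = {0..<card P}"
  define A where "A k = {x \<in> space m. p x = fst (e k) \<and> q x = snd (e k)}" for k
  have eP: "e k \<in> P" if "k \<in> I" for k
    using e that by (auto simp: I_def bij_betw_def)
  have "finite I" by (simp add: I_def)
  have disj: "disjoint_family_on A I"
    unfolding disjoint_family_on_def
  proof (intro ballI impI)
    fix i j assume ij: "i \<in> I" "j \<in> I" "i \<noteq> j"
    then have "e i \<noteq> e j"
      using e by (auto simp: I_def bij_betw_def inj_on_def)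
    then show "A i \<inter> A j = {}"
      by (auto simp: A_def prod_eq_iff)
  qed
  have Am: "A i \<in> sets m \<and> emeasure m (A i) < \<infinity>" if "i \<in> I" for i
  proof
    show "A i \<in> sets m" by (simp add: A_def)
    have "e i \<noteq> (0, 0)"
      using eP [OF that] by (auto simp: P_def)
    then have "emeasure m (A i) \<le> emeasure m ({x \<in> space m. p x \<noteq> 0} \<union> {x \<in> space m. q x \<noteq> 0})"
      by (intro emeasure_mono) (auto simp: A_def prod_eq_iff)
    also have "\<dots> \<le> emeasure m {x \<in> space m. p x \<noteq> 0} + emeasure m {x \<in> space m. q x \<noteq> 0}"
      by (intro emeasure_subadditive) auto
    also have "\<dots> < \<infinity>"
      using p q by (auto elim!: simple_bochner_integrable.cases simp: less_top)
    finally show "emeasure m (A i) < \<infinity>" .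
  qed
  have ne: "A i \<noteq> {}" if "i \<in> I" for i
    using eP [OF that] by (auto simp: A_def P_def)
  have cover: "\<exists>i\<in>I. x \<in> A i" if "x \<in> space m" "p x \<noteq> 0 \<or> q x \<noteq> 0" for x
  proof -
    have "(p x, q x) \<in> P" using that by (auto simp: P_def)
    then obtain i where "i \<in> I" "e i = (p x, q x)"
      by (metis I_def bij_betw_imp_surj_on e imageE)
    then show ?thesis using that by (intro bexI [of _ i]) (auto simp: A_def)
  qed
  have Ep: "AE \<omega> in N. elementary_wiener_integral m W p \<omega> = (\<Sum>i\<in>I. fst (e i) * W (A i) \<omega>)"
    using p \<open>finite I\<close> disj Am ne
    by (rule AE_elementary_wiener_integral_partition) (use cover in \<open>auto simp: A_def\<close>)
  have Eq: "AE \<omega> in N. elementary_wiener_integral m W q \<omega> = (\<Sum>i\<in>I. snd (e i) * W (A i) \<omega>)"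
    using q \<open>finite I\<close> disj Am ne
    by (rule AE_elementary_wiener_integral_partition) (use cover in \<open>auto simp: A_def\<close>)
  define c where "c i = fst (e i) - snd (e i)" for i
  \<comment> \<open>One number serves twice: it is the squared distance of \<open>p\<close> and
    \<open>q\<close> and the variance of the difference of their integrals.\<close>
  define v where "v = (\<Sum>i\<in>I. (c i)\<^sup>2 * measure m (A i))"
  show thesis
  proof
    show "0 \<le> v" by (auto simp: v_def intro!: sum_nonneg)
    have "ennreal ((p x - q x)\<^sup>2) = (\<Sum>i\<in>I. ennreal ((c i)\<^sup>2) * indicator (A i) x)"
      if x: "x \<in> space m" for x
    proof (cases "\<exists>i\<in>I. x \<in> A i")
      case True
      then obtain i where i: "i \<in> I" "x \<in> A i" by blast
      have "indicator (A j) x = (if j = i then 1 else 0 :: ennreal)" if "j \<in> I" for j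
        using i disj that by (auto simp: disjoint_family_on_def indicator_def)
      then have "(\<Sum>j\<in>I. ennreal ((c j)\<^sup>2) * indicator (A j) x)
          = (\<Sum>j\<in>I. if j = i then ennreal ((c i)\<^sup>2) else 0)"
        by (intro sum.cong) auto
      then show ?thesis
        using i \<open>finite I\<close> by (simp add: A_def c_def)
    next
      case False
      then have "p x = 0" "q x = 0"
        using cover x by auto
      then show ?thesis using False by simp
    qed
    then have "(\<integral>\<^sup>+ x. ennreal ((p x - q x)\<^sup>2) \<partial>m) = (\<integral>\<^sup>+ x. (\<Sum>i\<in>I. ennreal ((c i)\<^sup>2) * indicator (A i) x) \<partial>m)"
      by (intro nn_integral_cong)
    also have "\<dots> = (\<Sum>i\<in>I. ennreal ((c i)\<^sup>2) * emeasure m (A i))"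
      using Am
      by (subst nn_integral_sum)
        (auto simp: nn_integral_cmult_indicator intro!: borel_measurable_times_ennreal borel_measurable_indicator)
    also have "\<dots> = (\<Sum>i\<in>I. ennreal ((c i)\<^sup>2 * measure m (A i)))"
      using Am by (intro sum.cong) (auto simp: emeasure_eq_ennreal_measure ennreal_mult less_top)
    also have "\<dots> = ennreal v"
      by (simp add: v_def sum_ennreal)
    finally show "(\<integral>\<^sup>+ x. ennreal ((p x - q x)\<^sup>2) \<partial>m) = ennreal v" .
    fix l
    have "AE \<omega> in N. elementary_wiener_integral m W p \<omega> - elementary_wiener_integral m W q \<omega>
        = (\<Sum>i\<in>I. c i * W (A i) \<omega>)"
      using Ep Eq by eventually_elim (simp add: c_def left_diff_distrib sum_subtractf)
    then have "(\<integral>\<^sup>+ \<omega>. ennreal (exp (l * (elementary_wiener_integral m W p \<omega>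
        - elementary_wiener_integral m W q \<omega>))) \<partial>N)
        = (\<integral>\<^sup>+ \<omega>. ennreal (exp (l * (\<Sum>i\<in>I. c i * W (A i) \<omega>))) \<partial>N)"
      by (intro nn_integral_cong_AE) auto
    also have "\<dots> = ennreal (exp (l\<^sup>2 * v / 2))"
      unfolding v_def using \<open>finite I\<close> disj Am by (rule nn_integral_exp_sum_W)
    finally show "(\<integral>\<^sup>+ \<omega>. ennreal (exp (l * (elementary_wiener_integral m W p \<omega>
        - elementary_wiener_integral m W q \<omega>))) \<partial>N) = ennreal (exp (l\<^sup>2 * v / 2))" .
  qed
qed

section \<open>Tail bounds from exponential and second moments\<close>

lemma prob_elementary_wiener_integral_diff_le:
  assumes p: "Bochner_Integration.simple_bochner_integrable m p"
    and q: "Bochner_Integration.simple_bochner_integrable m q"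
    and V: "(\<integral>\<^sup>+ x. ennreal ((p x - q x)\<^sup>2) \<partial>m) \<le> ennreal V" "0 < V" and "0 < x"
  shows "prob {\<omega> \<in> space N. x \<le> \<bar>elementary_wiener_integral m W p \<omega> - elementary_wiener_integral m W q \<omega>\<bar>}
    \<le> 2 * exp (- x\<^sup>2 / (2 * V))"
proof -
  define D where "D \<omega> = elementary_wiener_integral m W p \<omega> - elementary_wiener_integral m W q \<omega>" for \<omega>
  have [measurable]: "D \<in> borel_measurable N"
    unfolding D_def [abs_def] using p q by (intro borel_measurable_diff measurable_elementary_wiener_integral)
  obtain v where v: "0 \<le> v" "(\<integral>\<^sup>+ x. ennreal ((p x - q x)\<^sup>2) \<partial>m) = ennreal v"
    "\<And>l. (\<integral>\<^sup>+ \<omega>. ennreal (exp (l * D \<omega>)) \<partial>N) = ennreal (exp (l\<^sup>2 * v / 2))"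
    unfolding D_def using elementary_wiener_integral_diff_moment [OF p q] by blast
  have "v \<le> V" using v V by simp
  have one: "prob {\<omega> \<in> space N. x \<le> \<sigma> * D \<omega>} \<le> exp (- x\<^sup>2 / (2 * V))" if "\<sigma> = 1 \<or> \<sigma> = -1" for \<sigma>
  proof -
    \<comment> \<open>Chernoff's choice: this \<open>l\<close> minimises
      \<open>- (l * x) + l\<^sup>2 * V / 2\<close>.\<close>
    define l where "l = x / V"
    have "l > 0" using \<open>0 < x\<close> \<open>0 < V\<close> by (simp add: l_def)
    have "emeasure N {\<omega> \<in> space N. x \<le> \<sigma> * D \<omega>}
        = emeasure N {\<omega> \<in> space N. 1 \<le> ennreal (exp (- (l * x))) * ennreal (exp ((l * \<sigma>) * D \<omega>))}"
    proof -
      have "1 \<le> ennreal (exp (- (l * x))) * ennreal (exp ((l * \<sigma>) * D \<omega>)) \<longleftrightarrow> x \<le> \<sigma> * D \<omega>" for \<omega>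
      proof -
        have "ennreal (exp (- (l * x))) * ennreal (exp ((l * \<sigma>) * D \<omega>)) = ennreal (exp (l * (\<sigma> * D \<omega> - x)))"
          by (simp add: ennreal_mult [symmetric] exp_add [symmetric] algebra_simps)
        moreover have "1 \<le> exp (l * (\<sigma> * D \<omega> - x)) \<longleftrightarrow> x \<le> \<sigma> * D \<omega>"
          using \<open>l > 0\<close> by (simp add: zero_le_mult_iff)
        ultimately show ?thesis by simp
      qed
      then show ?thesis by simp
    qed
    also have "\<dots> \<le> ennreal (exp (- (l * x))) * (\<integral>\<^sup>+ \<omega>. ennreal (exp ((l * \<sigma>) * D \<omega>)) * indicator (space N) \<omega> \<partial>N)"
      by (rule nn_integral_Markov_inequality) auto
    also have "(\<integral>\<^sup>+ \<omega>. ennreal (exp ((l * \<sigma>) * D \<omega>)) * indicator (space N) \<omega> \<partial>N)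
        = (\<integral>\<^sup>+ \<omega>. ennreal (exp ((l * \<sigma>) * D \<omega>)) \<partial>N)"
      by (intro nn_integral_cong) simp
    also have "\<dots> = ennreal (exp ((l * \<sigma>)\<^sup>2 * v / 2))"
      by (rule v(3))
    also have "ennreal (exp (- (l * x))) * \<dots> = ennreal (exp (- (l * x) + l\<^sup>2 * v / 2))"
      using that by (auto simp: ennreal_mult [symmetric] mult_exp_exp)
    also have "\<dots> \<le> ennreal (exp (- x\<^sup>2 / (2 * V)))"
    proof -
      have "l\<^sup>2 * v \<le> l\<^sup>2 * V"
        using \<open>v \<le> V\<close> by (intro mult_left_mono) auto
      also have "l\<^sup>2 * V = x\<^sup>2 / V" "l * x = x\<^sup>2 / V"
        using \<open>0 < V\<close> by (simp_all add: l_def power2_eq_square)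
      ultimately have "- (l * x) + l\<^sup>2 * v / 2 \<le> - x\<^sup>2 / (2 * V)"
        by (simp add: field_simps)
      then show ?thesis by simp
    qed
    finally show ?thesis
      by (simp add: emeasure_eq_measure)
  qed
  have "prob {\<omega> \<in> space N. x \<le> \<bar>D \<omega>\<bar>}
      \<le> prob ({\<omega> \<in> space N. x \<le> 1 * D \<omega>} \<union> {\<omega> \<in> space N. x \<le> -1 * D \<omega>})"
    by (intro finite_measure_mono) auto
  also have "\<dots> \<le> prob {\<omega> \<in> space N. x \<le> 1 * D \<omega>} + prob {\<omega> \<in> space N. x \<le> -1 * D \<omega>}"
    by (intro measure_Un_le) auto
  also have "\<dots> \<le> 2 * exp (- x\<^sup>2 / (2 * V))"
    using one [of 1] one [of "-1"] by simp
  finally show ?thesis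
    by (simp add: D_def)
qed

lemma prob_square_Markov:
  assumes [measurable]: "U \<in> borel_measurable N" and "0 < x" "0 \<le> \<epsilon>"
    and le: "(\<integral>\<^sup>+ \<omega>. ennreal ((U \<omega>)\<^sup>2) \<partial>N) \<le> ennreal (\<epsilon> * x\<^sup>2)"
  shows "prob {\<omega> \<in> space N. x \<le> \<bar>U \<omega>\<bar>} \<le> \<epsilon>"
proof -
  have "1 \<le> ennreal (1 / x\<^sup>2) * ennreal ((U \<omega>)\<^sup>2) \<longleftrightarrow> x \<le> \<bar>U \<omega>\<bar>" for \<omega>
  proof -
    have "1 \<le> ennreal (1 / x\<^sup>2) * ennreal ((U \<omega>)\<^sup>2) \<longleftrightarrow> x\<^sup>2 \<le> (U \<omega>)\<^sup>2"
      using \<open>0 < x\<close> by (simp add: ennreal_mult [symmetric] field_simps)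
    also have "\<dots> \<longleftrightarrow> x \<le> \<bar>U \<omega>\<bar>"
      using \<open>0 < x\<close> abs_le_square_iff [of x "U \<omega>"] by simp
    finally show ?thesis .
  qed
  then have "emeasure N {\<omega> \<in> space N. x \<le> \<bar>U \<omega>\<bar>}
      = emeasure N {\<omega> \<in> space N. 1 \<le> ennreal (1 / x\<^sup>2) * ennreal ((U \<omega>)\<^sup>2)}"
    by simp
  also have "\<dots> \<le> ennreal (1 / x\<^sup>2) * (\<integral>\<^sup>+ \<omega>. ennreal ((U \<omega>)\<^sup>2) * indicator (space N) \<omega> \<partial>N)"
    by (rule nn_integral_Markov_inequality) auto
  also have "(\<integral>\<^sup>+ \<omega>. ennreal ((U \<omega>)\<^sup>2) * indicator (space N) \<omega> \<partial>N) = (\<integral>\<^sup>+ \<omega>. ennreal ((U \<omega>)\<^sup>2) \<partial>N)"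
    by (intro nn_integral_cong) simp
  also have "ennreal (1 / x\<^sup>2) * \<dots> \<le> ennreal (1 / x\<^sup>2) * ennreal (\<epsilon> * x\<^sup>2)"
    using le by (rule mult_left_mono) simp
  also have "\<dots> = ennreal \<epsilon>"
    using \<open>0 < x\<close> \<open>0 \<le> \<epsilon>\<close> by (simp add: ennreal_mult [symmetric])
  finally show ?thesis
    using \<open>0 \<le> \<epsilon>\<close> by (simp add: emeasure_eq_measure)
qed

text \<open>Comparing with elementary integrals in probability gives a Gaussian tail without
  identifying the law of the limit; the factor \<open>6\<close> in the variance is harmless.\<close>

lemma prob_wiener_integral_diff_le:
  assumes f: "has_wiener_integral N m W f Y" and g: "has_wiener_integral N m W g Z"
    and V: "(\<integral>\<^sup>+ x. ennreal ((f x - g x)\<^sup>2) \<partial>m) \<le> ennreal V" "0 < V" and "0 < x"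
  shows "prob {\<omega> \<in> space N. 2 * x \<le> \<bar>Y \<omega> - Z \<omega>\<bar>} \<le> 2 * exp (- x\<^sup>2 / (12 * V))"
proof (rule field_le_epsilon)
  fix \<epsilon> :: real
  assume "\<epsilon> > 0"
  define E where "E = elementary_wiener_integral m W"
  obtain p where p: "\<And>n. Bochner_Integration.simple_bochner_integrable m (p n)"
    and pf: "(\<lambda>n. \<integral>\<^sup>+ x. ennreal ((p n x - f x)\<^sup>2) \<partial>m) \<longlonglongrightarrow> 0"
    and pY: "(\<lambda>n. \<integral>\<^sup>+ \<omega>. ennreal ((E (p n) \<omega> - Y \<omega>)\<^sup>2) \<partial>N) \<longlonglongrightarrow> 0"
    using f unfolding has_wiener_integral_def E_def by blast
  obtain q where q: "\<And>n. Bochner_Integration.simple_bochner_integrable m (q n)"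
    and qg: "(\<lambda>n. \<integral>\<^sup>+ x. ennreal ((q n x - g x)\<^sup>2) \<partial>m) \<longlonglongrightarrow> 0"
    and qZ: "(\<lambda>n. \<integral>\<^sup>+ \<omega>. ennreal ((E (q n) \<omega> - Z \<omega>)\<^sup>2) \<partial>N) \<longlonglongrightarrow> 0"
    using g unfolding has_wiener_integral_def E_def by blast
  have [measurable]: "Y \<in> borel_measurable N" "Z \<in> borel_measurable N"
    "f \<in> borel_measurable m" "g \<in> borel_measurable m"
    using f g by (auto simp: has_wiener_integral_def)
  have [measurable]: "p n \<in> borel_measurable m" "q n \<in> borel_measurable m" for n
    using p [of n] q [of n]
    by (auto elim!: simple_bochner_integrable.cases intro: borel_measurable_simple_function)
  have [measurable]: "E (p n) \<in> borel_measurable N" "E (q n) \<in> borel_measurable N" for n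
    unfolding E_def using p q by (auto intro: measurable_elementary_wiener_integral)
  \<comment> \<open>The thresholds: approximation errors \<open>V / 2\<close> give the squared
    distance of the simple functions the bound \<open>3 * (V / 2 + V + V / 2) = 6 * V\<close>, and
    the second one turns Markov's inequality at level \<open>x / 2\<close> into probability
    \<open>\<epsilon> / 2\<close> for each of the two errors.\<close>
  have "0 < ennreal (V / 2)" "0 < ennreal (\<epsilon> / 2 * (x / 2)\<^sup>2)"
    using \<open>0 < V\<close> \<open>0 < \<epsilon>\<close> \<open>0 < x\<close> by simp_all
  then have "\<forall>\<^sub>F n in sequentially. (\<integral>\<^sup>+ x. ennreal ((p n x - f x)\<^sup>2) \<partial>m) < ennreal (V / 2) \<and>
     (\<integral>\<^sup>+ x. ennreal ((q n x - g x)\<^sup>2) \<partial>m) < ennreal (V / 2) \<and>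
     (\<integral>\<^sup>+ \<omega>. ennreal ((E (p n) \<omega> - Y \<omega>)\<^sup>2) \<partial>N) < ennreal (\<epsilon> / 2 * (x / 2)\<^sup>2) \<and>
     (\<integral>\<^sup>+ \<omega>. ennreal ((E (q n) \<omega> - Z \<omega>)\<^sup>2) \<partial>N) < ennreal (\<epsilon> / 2 * (x / 2)\<^sup>2)"
    by (intro eventually_conj order_tendstoD [OF pf] order_tendstoD [OF qg]
        order_tendstoD [OF pY] order_tendstoD [OF qZ])
  then obtain n where n: "(\<integral>\<^sup>+ x. ennreal ((p n x - f x)\<^sup>2) \<partial>m) < ennreal (V / 2)"
     "(\<integral>\<^sup>+ x. ennreal ((q n x - g x)\<^sup>2) \<partial>m) < ennreal (V / 2)"
     "(\<integral>\<^sup>+ \<omega>. ennreal ((E (p n) \<omega> - Y \<omega>)\<^sup>2) \<partial>N) < ennreal (\<epsilon> / 2 * (x / 2)\<^sup>2)"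
     "(\<integral>\<^sup>+ \<omega>. ennreal ((E (q n) \<omega> - Z \<omega>)\<^sup>2) \<partial>N) < ennreal (\<epsilon> / 2 * (x / 2)\<^sup>2)"
    by (auto simp: eventually_sequentially)
  have "(\<integral>\<^sup>+ x. ennreal ((p n x - q n x)\<^sup>2) \<partial>m)
      \<le> (\<integral>\<^sup>+ x. 3 * (ennreal ((p n x - f x)\<^sup>2) + ennreal ((f x - g x)\<^sup>2) + ennreal ((q n x - g x)\<^sup>2)) \<partial>m)"
  proof (rule nn_integral_mono)
    fix x
    \<comment> \<open>The difference of the two sides is the sum of the squares of
      \<open>a - b\<close>, \<open>b - c\<close> and \<open>a - c\<close>.\<close>
    have "(a + b + c)\<^sup>2 \<le> 3 * (a\<^sup>2 + b\<^sup>2 + c\<^sup>2)" for a b c :: real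
      using sum_squares_ge_zero [of "a - b" "b - c"] zero_le_power2 [of "a - c"]
      by (simp add: power2_eq_square algebra_simps)
    from this [of "p n x - f x" "f x - g x" "g x - q n x"]
    have "(p n x - q n x)\<^sup>2 \<le> 3 * ((p n x - f x)\<^sup>2 + (f x - g x)\<^sup>2 + (q n x - g x)\<^sup>2)"
      by (simp add: power2_commute [of "q n x" "g x"])
    then have "ennreal ((p n x - q n x)\<^sup>2) \<le> ennreal (3 * ((p n x - f x)\<^sup>2 + (f x - g x)\<^sup>2 + (q n x - g x)\<^sup>2))"
      by (rule ennreal_leI)
    then show "ennreal ((p n x - q n x)\<^sup>2)
        \<le> 3 * (ennreal ((p n x - f x)\<^sup>2) + ennreal ((f x - g x)\<^sup>2) + ennreal ((q n x - g x)\<^sup>2))"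
      by (simp add: ennreal_mult ennreal_plus)
  qed
  also have "\<dots> = 3 * ((\<integral>\<^sup>+ x. ennreal ((p n x - f x)\<^sup>2) \<partial>m) + (\<integral>\<^sup>+ x. ennreal ((f x - g x)\<^sup>2) \<partial>m)
      + (\<integral>\<^sup>+ x. ennreal ((q n x - g x)\<^sup>2) \<partial>m))"
    by (simp add: nn_integral_cmult nn_integral_add)
  also have "\<dots> \<le> 3 * (ennreal (V / 2) + ennreal V + ennreal (V / 2))"
    using n V by (intro mult_left_mono add_mono) auto
  also have "\<dots> = ennreal 3 * ennreal (V / 2 + V + V / 2)"
    using \<open>0 < V\<close> by (simp add: ennreal_plus [symmetric] del: ennreal_plus)
  also have "\<dots> = ennreal (6 * V)"
    using \<open>0 < V\<close> by (subst ennreal_mult [symmetric]) auto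
  finally have "(\<integral>\<^sup>+ x. ennreal ((p n x - q n x)\<^sup>2) \<partial>m) \<le> ennreal (6 * V)" .
  then have 1: "prob {\<omega> \<in> space N. x \<le> \<bar>E (p n) \<omega> - E (q n) \<omega>\<bar>} \<le> 2 * exp (- x\<^sup>2 / (2 * (6 * V)))"
    unfolding E_def using \<open>0 < V\<close> \<open>0 < x\<close> p q by (intro prob_elementary_wiener_integral_diff_le) auto
  have 2: "prob {\<omega> \<in> space N. x / 2 \<le> \<bar>E (p n) \<omega> - Y \<omega>\<bar>} \<le> \<epsilon> / 2"
    using n(3) \<open>0 < x\<close> \<open>0 < \<epsilon>\<close> by (intro prob_square_Markov) auto
  have 3: "prob {\<omega> \<in> space N. x / 2 \<le> \<bar>E (q n) \<omega> - Z \<omega>\<bar>} \<le> \<epsilon> / 2"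
    using n(4) \<open>0 < x\<close> \<open>0 < \<epsilon>\<close> by (intro prob_square_Markov) auto
  \<comment> \<open>Since \<open>2 * x = x + x / 2 + x / 2\<close>, at least one of the three
    deviations reaches its share.\<close>
  have "prob {\<omega> \<in> space N. 2 * x \<le> \<bar>Y \<omega> - Z \<omega>\<bar>}
      \<le> prob ({\<omega> \<in> space N. x \<le> \<bar>E (p n) \<omega> - E (q n) \<omega>\<bar>} \<union>
          ({\<omega> \<in> space N. x / 2 \<le> \<bar>E (p n) \<omega> - Y \<omega>\<bar>} \<union> {\<omega> \<in> space N. x / 2 \<le> \<bar>E (q n) \<omega> - Z \<omega>\<bar>}))"
    by (intro finite_measure_mono) (auto simp: abs_if split: if_splits)
  also have "\<dots> \<le> prob {\<omega> \<in> space N. x \<le> \<bar>E (p n) \<omega> - E (q n) \<omega>\<bar>} +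
      prob ({\<omega> \<in> space N. x / 2 \<le> \<bar>E (p n) \<omega> - Y \<omega>\<bar>} \<union> {\<omega> \<in> space N. x / 2 \<le> \<bar>E (q n) \<omega> - Z \<omega>\<bar>})"
    by (intro measure_Un_le) auto
  also have "\<dots> \<le> prob {\<omega> \<in> space N. x \<le> \<bar>E (p n) \<omega> - E (q n) \<omega>\<bar>} +
      (prob {\<omega> \<in> space N. x / 2 \<le> \<bar>E (p n) \<omega> - Y \<omega>\<bar>} + prob {\<omega> \<in> space N. x / 2 \<le> \<bar>E (q n) \<omega> - Z \<omega>\<bar>})"
    by (intro add_left_mono measure_Un_le) auto
  also have "\<dots> \<le> 2 * exp (- x\<^sup>2 / (12 * V)) + \<epsilon>"
    using 1 2 3 by simp
  finally show "prob {\<omega> \<in> space N. 2 * x \<le> \<bar>Y \<omega> - Z \<omega>\<bar>} \<le> 2 * exp (- x\<^sup>2 / (12 * V)) + \<epsilon>" .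
qed

text \<open>Comparison with this integral shows later that the integral of the kernel at time 0
  vanishes almost surely.\<close>

lemma has_wiener_integral_zero: "has_wiener_integral N m W (\<lambda>_. 0) (\<lambda>_. 0)"
  unfolding has_wiener_integral_def
proof (intro conjI exI allI)
  show "Bochner_Integration.simple_bochner_integrable m (\<lambda>_. 0 :: real)" for n :: nat
    by (intro simple_bochner_integrable.intros) auto
qed (auto simp: elementary_wiener_integral_def image_constant_conv)

end

section \<open>Increments of the kernel\<close>

text \<open>After division by \<open>x + y\<close> the two fractions lie in (0, 1] and add up to 1,
  and an exponent at most 1 can only enlarge them.\<close>

lemma powr_add_le_add_powr:
  fixes x y a :: real
  assumes "0 \<le> x" "0 \<le> y" "0 \<le> a" "a \<le> 1"
  shows "(x + y) powr a \<le> x powr a + y powr a"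
proof (cases "x = 0 \<or> y = 0")
  case False
  then have xy: "0 < x" "0 < y" using assms by auto
  have le: "z powr 1 \<le> z powr a" if "0 < z" "z \<le> 1" for z :: real
    using that \<open>a \<le> 1\<close> by (intro powr_mono') auto
  have "x / (x + y) + y / (x + y) = 1"
    using xy by (simp add: add_divide_distrib [symmetric])
  then have "1 \<le> (x / (x + y)) powr a + (y / (x + y)) powr a"
    using le [of "x / (x + y)"] le [of "y / (x + y)"] xy by simp
  then have "(x + y) powr a * 1 \<le> (x + y) powr a * ((x / (x + y)) powr a + (y / (x + y)) powr a)"
    by (rule mult_left_mono) simp
  also have "\<dots> = x powr a + y powr a"
    using xy by (simp add: distrib_left powr_mult [symmetric])
  finally show ?thesis by simp
qed auto

lemma pos_powr_diff_le:
  assumes "0 < a" "a \<le> 1" "x \<le> y"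
  shows "\<bar>pos_powr y a - pos_powr x a\<bar> \<le> (y - x) powr a"
proof -
  consider "0 < x" | "x \<le> 0" "0 < y" | "y \<le> 0" by linarith
  then show ?thesis
  proof cases
    case 1
    have "y powr a \<le> x powr a + (y - x) powr a"
      using powr_add_le_add_powr [of x "y - x" a] 1 assms by simp
    moreover have "x powr a \<le> y powr a"
      using 1 assms by (intro powr_mono2) auto
    ultimately show ?thesis
      using 1 assms by (simp add: pos_powr_def)
  next
    case 2
    then show ?thesis
      using assms by (simp add: pos_powr_def powr_mono2)
  next
    case 3
    then show ?thesis
      using assms by (simp add: pos_powr_def)
  qed
qed

text \<open>Mean value theorem: the derivative is decreasing because \<open>a \<le> 1\<close>, so
  its value at the left end dominates.\<close>

lemma powr_diff_le:
  fixes x y a :: real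
  assumes "0 < a" "a \<le> 1" "0 < x" "x \<le> y"
  shows "\<bar>y powr a - x powr a\<bar> \<le> (y - x) * x powr (a - 1)"
proof (cases "x = y")
  case False
  then have "x < y" using assms by simp
  then obtain z where z: "x < z" "z < y" "y powr a - x powr a = (y - x) * (a * z powr (a - 1))"
    using MVT2 [of x y "\<lambda>w. w powr a" "\<lambda>w. a * w powr (a - 1)"] assms
      has_real_derivative_powr [of _ a] by force
  have "a * z powr (a - 1) \<le> 1 * x powr (a - 1)"
    using z assms by (intro mult_mono powr_mono2') auto
  then have "(y - x) * (a * z powr (a - 1)) \<le> (y - x) * x powr (a - 1)"
    using \<open>x < y\<close> by (intro mult_left_mono) auto
  moreover have "0 \<le> (y - x) * (a * z powr (a - 1))"
    using \<open>x < y\<close> assms by simp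
  ultimately show ?thesis
    using z(3) by simp
qed simp

section \<open>Integrals of powers over half lines and intervals\<close>

lemma nn_integral_powr_from_0:
  assumes "-1 < a" "0 \<le> (c :: real)"
  shows "(\<integral>\<^sup>+ x. ennreal (x powr a * indicator {0..c} x) \<partial>lborel) = ennreal (c powr (a + 1) / (a + 1))"
proof (rule nn_integral_has_integral_lborel)
  have "((\<lambda>x. if x \<in> {0..c} then x powr a else 0) has_integral (c powr (a + 1) / (a + 1))) UNIV"
    unfolding has_integral_restrict_UNIV using assms by (rule has_integral_powr_from_0)
  then show "((\<lambda>x. x powr a * indicator {0..c} x) has_integral (c powr (a + 1) / (a + 1))) UNIV"
    by (rule has_integral_eq [rotated]) auto
qed auto

lemma nn_integral_powr_to_inf:
  assumes "a < -1" "0 < (c :: real)"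
  shows "(\<integral>\<^sup>+ x. ennreal (x powr a * indicator {c..} x) \<partial>lborel) = ennreal (- (c powr (a + 1)) / (a + 1))"
proof (rule nn_integral_has_integral_lborel)
  have "((\<lambda>x. if x \<in> {c..} then x powr a else 0) has_integral (- (c powr (a + 1)) / (a + 1))) UNIV"
    unfolding has_integral_restrict_UNIV using assms by (rule has_integral_powr_to_inf)
  then show "((\<lambda>x. x powr a * indicator {c..} x) has_integral (- (c powr (a + 1)) / (a + 1))) UNIV"
    by (rule has_integral_eq [rotated]) auto
qed auto

lemma nn_integral_lborel_reflect:
  fixes f :: "real \<Rightarrow> ennreal"
  assumes [measurable]: "f \<in> borel_measurable borel"
  shows "(\<integral>\<^sup>+ x. f (- x) \<partial>lborel) = (\<integral>\<^sup>+ x. f x \<partial>lborel)"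
  using nn_integral_real_affine [of f "-1" 0] by simp

text \<open>The singularity of \<open>\<bar>u\<bar> powr (- \<gamma>)\<close> is integrable, so near the origin the Hoelder continuity
  of \<open>pos_powr\<close> suffices, while for \<open>u < - R\<close> the mean value theorem gives the decay.
  This is where \<open>\<alpha> > 0\<close> is used.\<close>

lemma nn_integral_gfbm_kernel_diff_le:
  assumes "0 \<le> \<gamma>" "\<gamma> < 1" "0 < \<alpha>" "\<alpha> < 1 / 2 + \<gamma> / 2"
    and st: "0 \<le> s" "s \<le> t" "t \<le> R" and "0 < R"
  shows "(\<integral>\<^sup>+ u. ennreal ((gfbm_kernel \<alpha> \<gamma> t u - gfbm_kernel \<alpha> \<gamma> s u)\<^sup>2) \<partial>lborel)
    \<le> ennreal ((2 / (1 - \<gamma>) + 1 / (1 + \<gamma> - 2 * \<alpha>)) * ((t - s) powr (2 * \<alpha>) * R powr (1 - \<gamma>)))"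
proof -
  define h where "h = t - s"
  \<comment> \<open>Both majorants live on the positive half line; the negative one is reached by
    reflection. The singular part \<open>G1\<close> is used on both sides of the origin, whence the
    2 in \<open>2 / (1 - \<gamma>)\<close>.\<close>
  define G1 where "G1 u = u powr (- \<gamma>) * indicator {0..R} u" for u :: real
  define G2 where "G2 u = u powr (2 * \<alpha> - 2 - \<gamma>) * indicator {R..} u" for u :: real
  have h: "0 \<le> h" "h \<le> R" using st by (auto simp: h_def)
  have "\<alpha> < 1" using assms by simp
  have [measurable]: "G1 \<in> borel_measurable borel" "G2 \<in> borel_measurable borel"
    by (simp_all add: G1_def [abs_def] G2_def [abs_def])
  have G0: "0 \<le> G1 u" "0 \<le> G2 u" for u
    by (auto simp: G1_def G2_def)
  have ker: "(gfbm_kernel \<alpha> \<gamma> t u - gfbm_kernel \<alpha> \<gamma> s u)\<^sup>2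
      = \<bar>pos_powr (t - u) \<alpha> - pos_powr (s - u) \<alpha>\<bar>\<^sup>2 * \<bar>u\<bar> powr (- \<gamma>)" for u
  proof -
    have "(\<bar>u\<bar> powr (- \<gamma> / 2))\<^sup>2 = \<bar>u\<bar> powr (- \<gamma>)"
      by (simp add: power2_eq_square powr_add [symmetric])
    then show ?thesis
      by (simp add: gfbm_kernel_def left_diff_distrib [symmetric] power_mult_distrib)
  qed
  have pw: "(gfbm_kernel \<alpha> \<gamma> t u - gfbm_kernel \<alpha> \<gamma> s u)\<^sup>2
      \<le> h powr (2 * \<alpha>) * (G1 u + G1 (- u)) + h\<^sup>2 * G2 (- u)" for u
  proof -
    consider "u > R" | "\<bar>u\<bar> \<le> R" | "u < - R" by linarith
    then show ?thesis
    proof cases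
      case 1
      \<comment> \<open>Here \<open>u\<close> exceeds both \<open>t\<close> and \<open>s\<close>, so
        the kernel difference is 0.\<close>
      then show ?thesis
        unfolding ker using st G0 by (simp add: pos_powr_def)
    next
      case 2
      have "\<bar>pos_powr (t - u) \<alpha> - pos_powr (s - u) \<alpha>\<bar>\<^sup>2 \<le> (h powr \<alpha>)\<^sup>2"
        using pos_powr_diff_le [of \<alpha> "s - u" "t - u"] assms \<open>\<alpha> < 1\<close>
        by (intro power_mono) (auto simp: h_def)
      also have "\<dots> = h powr (2 * \<alpha>)"
        by (simp add: power2_eq_square powr_add [symmetric])
      finally have "(gfbm_kernel \<alpha> \<gamma> t u - gfbm_kernel \<alpha> \<gamma> s u)\<^sup>2 \<le> h powr (2 * \<alpha>) * \<bar>u\<bar> powr (- \<gamma>)"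
        unfolding ker by (rule mult_right_mono) simp
      also have "\<bar>u\<bar> powr (- \<gamma>) \<le> G1 u + G1 (- u)"
        using 2 by (auto simp: G1_def indicator_def)
      finally show ?thesis
        using G0(2) [of "- u"] by (simp add: mult_left_mono add_increasing2)
    next
      case 3
      have "\<bar>pos_powr (t - u) \<alpha> - pos_powr (s - u) \<alpha>\<bar> = \<bar>(t - u) powr \<alpha> - (s - u) powr \<alpha>\<bar>"
        using 3 st \<open>0 < R\<close> by (simp add: pos_powr_def)
      also have "\<dots> \<le> h * (s - u) powr (\<alpha> - 1)"
        using powr_diff_le [of \<alpha> "s - u" "t - u"] 3 st \<open>0 < R\<close> assms \<open>\<alpha> < 1\<close> by (simp add: h_def)
      \<comment> \<open>The exponent \<alpha> - 1 is negative, so dropping \<open>s \<ge> 0\<close>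
        enlarges the power.\<close>
      also have "\<dots> \<le> h * (- u) powr (\<alpha> - 1)"
        using 3 st \<open>0 < R\<close> h \<open>\<alpha> < 1\<close> by (intro mult_left_mono powr_mono2') auto
      finally have "\<bar>pos_powr (t - u) \<alpha> - pos_powr (s - u) \<alpha>\<bar>\<^sup>2 \<le> (h * (- u) powr (\<alpha> - 1))\<^sup>2"
        by (rule power_mono) simp
      also have "\<dots> = h\<^sup>2 * (- u) powr (2 * \<alpha> - 2)"
        by (simp add: power_mult_distrib power2_eq_square powr_add [symmetric])
      finally have "(gfbm_kernel \<alpha> \<gamma> t u - gfbm_kernel \<alpha> \<gamma> s u)\<^sup>2
          \<le> h\<^sup>2 * (- u) powr (2 * \<alpha> - 2) * \<bar>u\<bar> powr (- \<gamma>)"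
        unfolding ker by (rule mult_right_mono) simp
      also have "\<dots> = h\<^sup>2 * G2 (- u)"
        using 3 \<open>0 < R\<close> by (simp add: G2_def powr_add [symmetric] mult.assoc)
      finally show ?thesis
        using G0 [of u] G0 [of "- u"] by (simp add: add_increasing)
    qed
  qed
  have I1: "(\<integral>\<^sup>+ u. ennreal (G1 u) \<partial>lborel) = ennreal (R powr (1 - \<gamma>) / (1 - \<gamma>))"
    using nn_integral_powr_from_0 [of "- \<gamma>" R] assms by (simp add: G1_def)
  \<comment> \<open>Integrability at infinity is the condition 2 * \<alpha> - 2 - \<gamma> < -1,
    that is, the upper bound on \<alpha>.\<close>
  have I2: "(\<integral>\<^sup>+ u. ennreal (G2 u) \<partial>lborel) = ennreal (R powr (2 * \<alpha> - 1 - \<gamma>) / (1 + \<gamma> - 2 * \<alpha>))"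
  proof -
    have "- (R powr (2 * \<alpha> - 2 - \<gamma> + 1)) / (2 * \<alpha> - 2 - \<gamma> + 1)
        = - (R powr (2 * \<alpha> - 1 - \<gamma>)) / - (1 + \<gamma> - 2 * \<alpha>)"
      by (intro arg_cong2 [where f = "(/)"] arg_cong [where f = uminus] arg_cong2 [where f = "(powr)"]) auto
    also have "\<dots> = R powr (2 * \<alpha> - 1 - \<gamma>) / (1 + \<gamma> - 2 * \<alpha>)"
      by (metis minus_divide_left minus_divide_right minus_minus)
    finally show ?thesis
      using nn_integral_powr_to_inf [of "2 * \<alpha> - 2 - \<gamma>" R] assms by (simp add: G2_def)
  qed
  have "(\<integral>\<^sup>+ u. ennreal ((gfbm_kernel \<alpha> \<gamma> t u - gfbm_kernel \<alpha> \<gamma> s u)\<^sup>2) \<partial>lborel)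
      \<le> (\<integral>\<^sup>+ u. ennreal (h powr (2 * \<alpha>)) * (ennreal (G1 u) + ennreal (G1 (- u))) + ennreal (h\<^sup>2) * ennreal (G2 (- u)) \<partial>lborel)"
  proof (rule nn_integral_mono)
    fix u
    show "ennreal ((gfbm_kernel \<alpha> \<gamma> t u - gfbm_kernel \<alpha> \<gamma> s u)\<^sup>2)
        \<le> ennreal (h powr (2 * \<alpha>)) * (ennreal (G1 u) + ennreal (G1 (- u))) + ennreal (h\<^sup>2) * ennreal (G2 (- u))"
      using ennreal_leI [OF pw [of u]] G0 by (simp add: ennreal_plus ennreal_mult)
  qed
  also have "\<dots> = ennreal (h powr (2 * \<alpha>)) *
      ((\<integral>\<^sup>+ u. ennreal (G1 u) \<partial>lborel) + (\<integral>\<^sup>+ u. ennreal (G1 (- u)) \<partial>lborel))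
      + ennreal (h\<^sup>2) * (\<integral>\<^sup>+ u. ennreal (G2 (- u)) \<partial>lborel)"
    by (simp add: nn_integral_add nn_integral_cmult)
  also have "(\<integral>\<^sup>+ u. ennreal (G1 (- u)) \<partial>lborel) = (\<integral>\<^sup>+ u. ennreal (G1 u) \<partial>lborel)"
    by (rule nn_integral_lborel_reflect) simp
  also have "(\<integral>\<^sup>+ u. ennreal (G2 (- u)) \<partial>lborel) = (\<integral>\<^sup>+ u. ennreal (G2 u) \<partial>lborel)"
    by (rule nn_integral_lborel_reflect) simp
  also have "ennreal (h powr (2 * \<alpha>)) * ((\<integral>\<^sup>+ u. ennreal (G1 u) \<partial>lborel) + (\<integral>\<^sup>+ u. ennreal (G1 u) \<partial>lborel))
      + ennreal (h\<^sup>2) * (\<integral>\<^sup>+ u. ennreal (G2 u) \<partial>lborel)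
    = ennreal (h powr (2 * \<alpha>) * (R powr (1 - \<gamma>) / (1 - \<gamma>) + R powr (1 - \<gamma>) / (1 - \<gamma>))
        + h\<^sup>2 * (R powr (2 * \<alpha> - 1 - \<gamma>) / (1 + \<gamma> - 2 * \<alpha>)))"
  proof -
    have "ennreal x * (ennreal y + ennreal z) + ennreal w * ennreal v = ennreal (x * (y + z) + w * v)"
      if "0 \<le> x" "0 \<le> y" "0 \<le> z" "0 \<le> w" "0 \<le> v" for x y z w v
      using that by (simp add: ennreal_plus ennreal_mult)
    then show ?thesis
      unfolding I1 I2 using assms by simp
  qed
  also have "\<dots> \<le> ennreal ((2 / (1 - \<gamma>) + 1 / (1 + \<gamma> - 2 * \<alpha>)) * (h powr (2 * \<alpha>) * R powr (1 - \<gamma>)))"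
  proof (rule ennreal_leI)
    \<comment> \<open>Trading part of \<open>h\<^sup>2\<close> for a power of \<open>R\<close>,
      possible since \<open>h \<le> R\<close>, gives the far part the same form as the near
      part.\<close>
    have "h\<^sup>2 = h powr (2 * \<alpha>) * h powr (2 - 2 * \<alpha>)"
      using h by (cases "h = 0") (simp_all add: powr_add [symmetric])
    also have "\<dots> \<le> h powr (2 * \<alpha>) * R powr (2 - 2 * \<alpha>)"
      using h \<open>\<alpha> < 1\<close> by (intro mult_left_mono powr_mono2) auto
    finally have "h\<^sup>2 * R powr (2 * \<alpha> - 1 - \<gamma>) \<le> h powr (2 * \<alpha>) * R powr (2 - 2 * \<alpha>) * R powr (2 * \<alpha> - 1 - \<gamma>)"
      by (rule mult_right_mono) simp
    also have "\<dots> = h powr (2 * \<alpha>) * R powr (1 - \<gamma>)"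
      by (simp add: mult.assoc powr_add [symmetric])
    finally have "h\<^sup>2 * R powr (2 * \<alpha> - 1 - \<gamma>) / (1 + \<gamma> - 2 * \<alpha>) \<le> h powr (2 * \<alpha>) * R powr (1 - \<gamma>) / (1 + \<gamma> - 2 * \<alpha>)"
      using assms by (intro divide_right_mono) auto
    then show "h powr (2 * \<alpha>) * (R powr (1 - \<gamma>) / (1 - \<gamma>) + R powr (1 - \<gamma>) / (1 - \<gamma>))
        + h\<^sup>2 * (R powr (2 * \<alpha> - 1 - \<gamma>) / (1 + \<gamma> - 2 * \<alpha>))
      \<le> (2 / (1 - \<gamma>) + 1 / (1 + \<gamma> - 2 * \<alpha>)) * (h powr (2 * \<alpha>) * R powr (1 - \<gamma>))"
      by (simp add: algebra_simps)
  qed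
  finally show ?thesis
    by (simp add: h_def)
qed

lemma gfbm_kernel_zero: "gfbm_kernel \<alpha> \<gamma> 0 = (\<lambda>_. 0)"
  by (simp add: gfbm_kernel_def fun_eq_iff)

section \<open>Chaining\<close>

text \<open>A point of level j + 1 is either a point of level j or the right neighbour of one, so a
  grid point is reached from 0 with at most one increment per level. Continuity extends the bound
  from the grid to \<open>t\<close>.\<close>

lemma dyadic_chaining:
  fixes f :: "real \<Rightarrow> real" and R :: real
  assumes cont: "continuous_on {0..R} f" and "0 < R"
    and d: "\<And>j k. k < 2 ^ j \<Longrightarrow> \<bar>f (R * real (Suc k) / 2 ^ j) - f (R * real k / 2 ^ j)\<bar> \<le> d j"
    and "summable d" and t: "0 \<le> t" "t \<le> R"
  shows "\<bar>f t - f 0\<bar> \<le> suminf d"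
proof -
  have d0: "0 \<le> d j" for j
    using d [of 0 j] by (auto intro: order_trans [OF abs_ge_zero])
  have grid: "\<bar>f (R * real k / 2 ^ j) - f 0\<bar> \<le> (\<Sum>i\<le>j. d i)" if "k \<le> 2 ^ j" for j k
    using that
  proof (induction j arbitrary: k)
    case 0
    then consider "k = 0" | "k = 1" by fastforce
    then show ?case
      using d [of 0 0] d0 [of 0] by cases auto
  next
    case (Suc j)
    obtain i where i: "k = 2 * i \<or> k = Suc (2 * i)"
      by (metis oddE evenE Suc_eq_plus1)
    then have "i \<le> 2 ^ j" using Suc.prems by auto
    note IH = Suc.IH [OF this]
    have eq: "R * real (2 * i) / 2 ^ Suc j = R * real i / 2 ^ j" by simp
    from i show ?case
    proof
      assume "k = 2 * i"
      then show ?thesis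
        using IH eq d0 [of "Suc j"] by simp
    next
      assume k: "k = Suc (2 * i)"
      then have "\<bar>f (R * real k / 2 ^ Suc j) - f (R * real (2 * i) / 2 ^ Suc j)\<bar> \<le> d (Suc j)"
        using d [of "2 * i" "Suc j"] Suc.prems by simp
      then have "\<bar>f (R * real k / 2 ^ Suc j) - f 0\<bar> \<le> d (Suc j) + (\<Sum>i\<le>j. d i)"
        unfolding eq using IH by linarith
      then show ?thesis by simp
    qed
  qed
  \<comment> \<open>The largest point of level \<open>j\<close> that does not exceed
    \<open>t\<close>; it is within \<open>R * (1 / 2) ^ j\<close> of \<open>t\<close>.\<close>
  define r where "r j = R * real (nat \<lfloor>t * 2 ^ j / R\<rfloor>) / 2 ^ j" for j :: nat
  have r_le: "t - R * (1 / 2) ^ j \<le> r j" "r j \<le> t" for j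
  proof -
    define z where "z = t * 2 ^ j / R"
    have "0 \<le> z" using t \<open>0 < R\<close> by (simp add: z_def)
    then have "z - 1 \<le> real (nat \<lfloor>z\<rfloor>)" "real (nat \<lfloor>z\<rfloor>) \<le> z"
      by linarith+
    then have "R * (z - 1) / 2 ^ j \<le> r j" "r j \<le> R * z / 2 ^ j"
      using \<open>0 < R\<close> by (auto simp: r_def z_def [symmetric] intro!: divide_right_mono mult_left_mono)
    moreover have "R * z / 2 ^ j = t" "R * (z - 1) / 2 ^ j = t - R * (1 / 2) ^ j"
      using \<open>0 < R\<close> by (simp_all add: z_def field_simps power_divide)
    ultimately show "t - R * (1 / 2) ^ j \<le> r j" "r j \<le> t" by simp_all
  qed
  have "(\<lambda>j. t - R * (1 / 2) ^ j) \<longlonglongrightarrow> t - R * 0"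
    by (intro tendsto_intros LIMSEQ_power_zero) simp
  then have r_lim: "r \<longlonglongrightarrow> t"
    by (intro real_tendsto_sandwich [of "\<lambda>j. t - R * (1 / 2) ^ j" r _ "\<lambda>_. t"] always_eventually)
      (use r_le in auto)
  have r0: "0 \<le> r j" for j
    using \<open>0 < R\<close> by (simp add: r_def)
  have "(\<lambda>j. f (r j)) \<longlonglongrightarrow> f t"
    using continuous_on_tendsto_compose [OF cont r_lim] t r_le(2) r0
    by (auto intro: order_trans always_eventually)
  then have "(\<lambda>j. \<bar>f (r j) - f 0\<bar>) \<longlonglongrightarrow> \<bar>f t - f 0\<bar>"
    by (intro tendsto_intros)
  moreover have "\<bar>f (r j) - f 0\<bar> \<le> suminf d" for j
  proof -
    have "t * 2 ^ j / R \<le> 2 ^ j"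
      using t \<open>0 < R\<close> by (simp add: field_simps)
    then have "\<lfloor>t * 2 ^ j / R\<rfloor> \<le> 2 ^ j"
      by (metis floor_mono floor_of_int of_int_numeral of_int_power)
    then have "nat \<lfloor>t * 2 ^ j / R\<rfloor> \<le> 2 ^ j"
      by (simp add: nat_le_iff)
    then have "\<bar>f (r j) - f 0\<bar> \<le> (\<Sum>i\<le>j. d i)"
      unfolding r_def by (rule grid)
    also have "\<dots> \<le> suminf d"
      using \<open>summable d\<close> d0 by (intro sum_le_suminf) auto
    finally show ?thesis .
  qed
  ultimately show ?thesis
    by (intro LIMSEQ_le_const2) auto
qed

lemma (in prob_space) AE_bound_near_0:
  fixes X :: "real \<Rightarrow> 'a \<Rightarrow> real" and a b B :: real
  assumes X: "\<And>t. 0 \<le> t \<Longrightarrow> random_variable borel (X t)"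
    and cont: "\<And>\<omega>. \<omega> \<in> space M \<Longrightarrow> continuous_on {0..} (\<lambda>t. X t \<omega>)"
    and "0 < a" "0 < B"
    and tail: "\<And>s t R x. 0 \<le> s \<Longrightarrow> s < t \<Longrightarrow> t \<le> R \<Longrightarrow> 0 < x \<Longrightarrow>
      prob {\<omega> \<in> space M. B * x * ((t - s) powr a * R powr b) \<le> \<bar>X t \<omega> - X s \<omega>\<bar>} \<le> 2 * exp (- x\<^sup>2)"
  obtains K where "0 \<le> K"
    "AE \<omega> in M. \<forall>\<^sub>F n in sequentially. \<forall>t\<in>{0..exp (- real n)}.
       \<bar>X t \<omega> - X 0 \<omega>\<bar> \<le> K * (sqrt (ln (real n)) * exp (- real n) powr (a + b))"
proof
  \<comment> \<open>Halving the lag multiplies the scale of an increment by \<open>q\<close>. The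
    \<open>(1 - q)\<^sup>2\<close> in \<open>K\<close> comes from summing
    \<open>(j + 1) * q ^ j\<close>.\<close>
  define q :: real where "q = 2 powr (- a)"
  define K where "K = B * sqrt 2 / (1 - q)\<^sup>2"
  have q: "0 < q" "q < 1"
    using \<open>0 < a\<close> by (auto simp: q_def powr_less_one)
  \<comment> \<open>Chosen so that \<open>exp (- (x n j)\<^sup>2)\<close> is
    \<open>exp (- 2 * j) / n\<^sup>2\<close>: the factor in \<open>j\<close> outweighs the
    \<open>2 ^ j\<close> increments of level \<open>j\<close>, and the factor in \<open>n\<close> is
    summable for Borel--Cantelli.\<close>
  define x where "x n j = sqrt (2 * (ln (real n) + real j))" for n j :: nat
  define R where "R n = exp (- real n)" for n :: nat
  define y where "y n j = B * x n j * ((R n / 2 ^ j) powr a * R n powr b)" for n j :: nat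
  define D where "D n j k = (\<lambda>\<omega>. \<bar>X (R n * real (Suc k) / 2 ^ j) \<omega> - X (R n * real k / 2 ^ j) \<omega>\<bar>)" for n j k :: nat
  define A where "A n j k = {\<omega> \<in> space M. y n j \<le> D n j k \<omega>}" for n j k :: nat
  \<comment> \<open>From 3 on, \<open>ln n \<ge> 1\<close>, which the estimates below use; the
    earlier blocks do not affect an eventual statement.\<close>
  define U where "U n = (if n < 3 then {} else \<Union>j. \<Union>k<2^j. A n j k)" for n :: nat
  have R: "0 < R n" for n by (simp add: R_def)
  have D [measurable]: "D n j k \<in> borel_measurable M" for n j k
    unfolding D_def using R [of n] by (intro borel_measurable_abs borel_measurable_diff X) auto
  have A [measurable]: "A n j k \<in> sets M" for n j k
    by (simp add: A_def)
  have U [measurable]: "U n \<in> sets M" for n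
    by (auto simp: U_def)
  have ln1: "1 \<le> ln (real n)" if "n \<ge> 3" for n
  proof -
    have "exp 1 \<le> real n" using exp_le that by linarith
    then show ?thesis
      using that by (subst ln_ge_iff) auto
  qed
  have exp2: "exp (-2 :: real) \<le> 1 / 4"
  proof -
    have "(2 :: real) * 2 \<le> exp 1 * exp 1"
      using exp_ge_add_one_self [of 1] by (intro mult_mono) auto
    then have "4 \<le> exp (2 :: real)"
      by (simp add: mult_exp_exp)
    then show ?thesis
      by (simp add: exp_minus field_simps)
  qed
  have PA: "prob (A n j k) \<le> 2 / (real n)\<^sup>2 * (1 / 4) ^ j" if "n \<ge> 3" "k < 2 ^ j" for n j k
  proof -
    have "0 < ln (real n) + real j"
      using ln1 [OF that(1)] by linarith
    then have xx: "0 < x n j" "(x n j)\<^sup>2 = 2 * (ln (real n) + real j)"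
      by (auto simp: x_def)
    have "real (Suc k) \<le> real (2 ^ j)"
      using that(2) by (subst of_nat_le_iff) simp
    then have "R n * real (Suc k) \<le> R n * 2 ^ j"
      using R [of n] by (intro mult_left_mono) auto
    then have "R n * real (Suc k) / 2 ^ j \<le> R n"
      by (subst pos_divide_le_eq) auto
    moreover have "R n * real k / 2 ^ j < R n * real (Suc k) / 2 ^ j"
      using R [of n] by (intro divide_strict_right_mono mult_strict_left_mono) auto
    moreover have "R n * real (Suc k) / 2 ^ j - R n * real k / 2 ^ j = R n / 2 ^ j"
      by (simp add: field_simps)
    ultimately have "prob (A n j k) \<le> 2 * exp (- (x n j)\<^sup>2)"
      using tail [of "R n * real k / 2 ^ j" "R n * real (Suc k) / 2 ^ j" "R n" "x n j"] R [of n] xx(1)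
      by (simp add: A_def D_def y_def)
    also have "exp (- (x n j)\<^sup>2) = exp (- ln (real n) * 2) * exp (-2 * real j)"
      unfolding xx(2) by (simp add: mult_exp_exp algebra_simps)
    also have "exp (- ln (real n) * 2) = 1 / (real n)\<^sup>2"
      using that by (simp add: exp_minus exp_double mult.commute [of _ 2] inverse_eq_divide flip: exp_of_nat_mult)
    also have "exp (-2 * real j) = exp (-2) ^ j"
      by (simp add: exp_of_nat_mult [symmetric] mult.commute)
    also have "2 * (1 / (real n)\<^sup>2 * exp (-2) ^ j) \<le> 2 * (1 / (real n)\<^sup>2 * (1 / 4) ^ j)"
      using exp2 by (intro mult_left_mono power_mono) auto
    finally show ?thesis by simp
  qed
  have PU: "prob (U n) \<le> 4 * inverse ((real n)\<^sup>2)" for n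
  proof (cases "n < 3")
    case False
    then have n: "n \<ge> 3" by simp
    \<comment> \<open>Level \<open>j\<close> has \<open>2 ^ j\<close> events of probability at most
      \<open>2 / n\<^sup>2 * (1 / 4) ^ j\<close>; the geometric sum over the levels then gives
      \<open>4 / n\<^sup>2\<close>.\<close>
    have "emeasure M (\<Union>k<2^j. A n j k) \<le> ennreal (2 / (real n)\<^sup>2 * (1 / 2) ^ j)" for j
    proof -
      have "emeasure M (\<Union>k<2^j. A n j k) \<le> (\<Sum>k<2^j. emeasure M (A n j k))"
        by (intro emeasure_subadditive_finite) auto
      also have "\<dots> \<le> (\<Sum>k<(2::nat)^j. ennreal (2 / (real n)\<^sup>2 * (1 / 4) ^ j))"
        using PA [OF n] by (intro sum_mono) (auto simp: emeasure_eq_measure intro!: ennreal_leI)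
      also have "\<dots> = ennreal (\<Sum>k<(2::nat)^j. 2 / (real n)\<^sup>2 * (1 / 4) ^ j)"
        by (rule sum_ennreal) simp
      also have "(\<Sum>k<(2::nat)^j. 2 / (real n)\<^sup>2 * (1 / 4) ^ j) = 2 / (real n)\<^sup>2 * (2 ^ j * (1 / 4) ^ j)"
        by simp
      also have "2 ^ j * (1 / 4) ^ j = (1 / 2 :: real) ^ j"
        by (simp add: power_mult_distrib [symmetric])
      finally show ?thesis .
    qed
    then have "(\<Sum>j. emeasure M (\<Union>k<2^j. A n j k)) \<le> (\<Sum>j. ennreal (2 / (real n)\<^sup>2 * (1 / 2) ^ j))"
      by (intro suminf_le) auto
    also have "\<dots> = ennreal (\<Sum>j. 2 / (real n)\<^sup>2 * (1 / 2) ^ j)"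
      by (rule suminf_ennreal2) (auto intro!: summable_mult summable_geometric)
    also have "(\<Sum>j. 2 / (real n)\<^sup>2 * (1 / 2) ^ j) = 4 * inverse ((real n)\<^sup>2)"
      by (subst suminf_mult) (auto intro!: summable_geometric simp: suminf_geometric field_simps)
    finally have "(\<Sum>j. emeasure M (\<Union>k<2^j. A n j k)) \<le> ennreal (4 * inverse ((real n)\<^sup>2))" .
    moreover have "emeasure M (U n) \<le> (\<Sum>j. emeasure M (\<Union>k<2^j. A n j k))"
      using False by (auto simp: U_def intro!: emeasure_subadditive_countably)
    ultimately have "emeasure M (U n) \<le> ennreal (4 * inverse ((real n)\<^sup>2))"
      by (rule order_trans [rotated])
    then show ?thesis
      by (simp add: emeasure_eq_measure)
  qed (simp add: U_def)
  have "summable (\<lambda>n. 4 * inverse ((real n)\<^sup>2))"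
    by (intro summable_mult inverse_power_summable) simp
  then have "summable (\<lambda>n. prob (U n))"
    by (rule summable_comparison_test') (use PU in simp)
  then have BC: "AE \<omega> in M. \<forall>\<^sub>F n in sequentially. \<omega> \<in> space M - U n"
    by (intro borel_cantelli_AE1) (auto simp: emeasure_eq_measure)
  show "0 \<le> K"
    using \<open>0 < B\<close> by (simp add: K_def)
  from BC show "AE \<omega> in M. \<forall>\<^sub>F n in sequentially. \<forall>t\<in>{0..exp (- real n)}.
       \<bar>X t \<omega> - X 0 \<omega>\<bar> \<le> K * (sqrt (ln (real n)) * exp (- real n) powr (a + b))"
  proof eventually_elim
    case (elim \<omega>)
    from elim eventually_ge_at_top [of 3] show ?case
    proof eventually_elim
      case (elim n)
      define c where "c = B * sqrt 2 * sqrt (ln (real n)) * R n powr (a + b)"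
      define d where "d j = c * (of_nat (Suc j) * q ^ j)" for j
      have geo: "(\<lambda>j. of_nat (Suc j) * q ^ j) sums (1 / (1 - q)\<^sup>2)"
        using q by (intro geometric_deriv_sums) simp
      have y_le: "y n j \<le> d j" for j
      proof -
        \<comment> \<open>The dependence on \<open>n\<close> must factor out of the sum over the
          levels. Since \<open>ln n \<ge> 1\<close>, the level costs only a factor
          \<open>j + 1\<close>, which is harmless against \<open>q ^ j\<close>.\<close>
        have "sqrt (ln (real n) + real j) \<le> sqrt (ln (real n) * (real (Suc j))\<^sup>2)"
        proof (rule real_sqrt_le_mono)
          have "real j * 1 \<le> real j * ln (real n)"
            using ln1 [OF elim(2)] by (intro mult_left_mono) auto
          then have "ln (real n) + real j \<le> ln (real n) * real (Suc j)"
            by (simp add: algebra_simps)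
          also have "\<dots> \<le> ln (real n) * (real (Suc j))\<^sup>2"
            using ln1 [OF elim(2)] by (intro mult_left_mono) (auto simp: power2_eq_square)
          finally show "ln (real n) + real j \<le> ln (real n) * (real (Suc j))\<^sup>2" .
        qed
        then have "x n j \<le> sqrt 2 * (sqrt (ln (real n)) * real (Suc j))"
          by (simp add: x_def real_sqrt_mult del: distrib_left_numeral)
        moreover have "(R n / 2 ^ j) powr a = R n powr a * q ^ j"
          using R [of n]
          by (simp add: q_def powr_divide powr_minus powr_powr powr_realpow [symmetric] mult.commute field_simps)
        ultimately have "y n j \<le> B * (sqrt 2 * (sqrt (ln (real n)) * real (Suc j))) * (R n powr a * q ^ j * R n powr b)"
          unfolding y_def using \<open>0 < B\<close> q ln1 [OF elim(2)]
          by (intro mult_mono mult_nonneg_nonneg) (auto simp: x_def)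
        also have "\<dots> = d j"
          by (simp add: d_def c_def powr_add algebra_simps)
        finally show ?thesis .
      qed
      have "\<bar>X t \<omega> - X 0 \<omega>\<bar> \<le> suminf d" if t: "t \<in> {0..exp (- real n)}" for t
      proof (rule dyadic_chaining [where f = "\<lambda>t. X t \<omega>" and R = "R n"])
        show "continuous_on {0..R n} (\<lambda>t. X t \<omega>)"
          using cont [of \<omega>] elim by (auto intro: continuous_on_subset)
        show "0 < R n" by (rule R)
        show "\<bar>X (R n * real (Suc k) / 2 ^ j) \<omega> - X (R n * real k / 2 ^ j) \<omega>\<bar> \<le> d j"
          if "k < 2 ^ j" for j k
        proof -
          have "\<omega> \<notin> A n j k"
            using elim that by (auto simp: U_def split: if_splits)
          then have "D n j k \<omega> \<le> y n j"
            using elim by (auto simp: A_def)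
          also note y_le
          finally show ?thesis by (simp add: D_def)
        qed
        show "summable d"
          unfolding d_def by (intro summable_mult sums_summable [OF geo])
      qed (use t in \<open>auto simp: R_def\<close>)
      moreover have "suminf d = c * (1 / (1 - q)\<^sup>2)"
        unfolding d_def using sums_mult [OF geo] by (rule sums_unique [symmetric])
      moreover have "\<dots> = K * (sqrt (ln (real n)) * exp (- real n) powr (a + b))"
        by (simp add: c_def K_def R_def)
      ultimately show ?case by simp
    qed
  qed
qed

section \<open>The iterated logarithm bound\<close>

lemma Limsup_iterated_log_finite:
  fixes f :: "real \<Rightarrow> real" and H K t :: real
  assumes "0 < t" "0 \<le> K" "0 \<le> H"
    and bound: "\<forall>\<^sub>F n in sequentially. \<forall>s\<in>{0..exp (- real n)}.
      \<bar>f s\<bar> \<le> K * (sqrt (ln (real n)) * exp (- real n) powr H)"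
  shows "\<exists>L::real. Limsup (at_right 0)
    (\<lambda>u. ereal (\<bar>f (u * t)\<bar> / (u powr H * sqrt (ln (ln (1 / u)))))) = ereal L"
proof -
  define F where "F u = \<bar>f (u * t)\<bar> / (u powr H * sqrt (ln (ln (1 / u))))" for u
  \<comment> \<open>\<open>sqrt 2\<close> arises from \<open>ln n \<le> ln (w\<^sup>2)\<close>, and
    \<open>exp 1 * t\<close> from rounding to a block: \<open>exp (- n)\<close> exceeds
    \<open>s = u * t\<close> by at most the factor \<open>exp 1\<close>.\<close>
  define C where "C = K * sqrt 2 * (exp 1 * t) powr H"
  obtain m where m: "\<And>n s. n \<ge> m \<Longrightarrow> s \<in> {0..exp (- real n)} \<Longrightarrow>
      \<bar>f s\<bar> \<le> K * (sqrt (ln (real n)) * exp (- real n) powr H)"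
    using bound unfolding eventually_sequentially by blast
  \<comment> \<open>\<open>u < t\<close> gives \<open>- ln s \<le> 2 * w\<close>; the second entry
    puts \<open>s\<close> into a block of index at least \<open>m\<close> and at least 1; the third
    gives \<open>w > 2\<close>, hence \<open>ln w > 0\<close> and
    \<open>2 * w \<le> w\<^sup>2\<close>.\<close>
  define \<delta> where "\<delta> = Min {t, exp (- (real m + 1)) / t, exp (-2)}"
  have "0 < \<delta>" using \<open>0 < t\<close> by (simp add: \<delta>_def)
  have *: "0 \<le> F u \<and> F u \<le> C" if u: "0 < u" "u < \<delta>" for u
  proof -
    have u': "u < t" "u < exp (- (real m + 1)) / t" "u < exp (-2)"
      using u by (simp_all add: \<delta>_def)
    define s where "s = u * t"
    define w where "w = ln (1 / u)"
    define n where "n = nat \<lfloor>- ln s\<rfloor>"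
    have "0 < s" using u \<open>0 < t\<close> by (simp add: s_def)
    have "s < exp (- (real m + 1))"
      using u'(2) \<open>0 < t\<close> by (simp add: s_def pos_less_divide_eq)
    then have ls: "real m + 1 < - ln s"
      using \<open>0 < s\<close> ln_less_cancel_iff [of s "exp (- (real m + 1))"] by simp
    then have "real n \<le> - ln s" "- ln s < real n + 1" "m \<le> n" "1 \<le> n"
      unfolding n_def by linarith+
    have "2 < w"
      using u u'(3) ln_less_cancel_iff [of u "exp (-2)"] by (simp add: w_def ln_div)
    have "s \<in> {0..exp (- real n)}"
      using \<open>0 < s\<close> \<open>real n \<le> - ln s\<close> ln_le_cancel_iff [of s "exp (- real n)"] by simp
    then have "\<bar>f s\<bar> \<le> K * (sqrt (ln (real n)) * exp (- real n) powr H)"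
      by (rule m [OF \<open>m \<le> n\<close>])
    also have "\<dots> \<le> K * ((sqrt 2 * sqrt (ln w)) * ((exp 1 * t) powr H * u powr H))"
    proof (intro mult_left_mono mult_mono)
      have "- ln s \<le> 2 * w"
        using u u' \<open>0 < t\<close> by (simp add: s_def w_def ln_mult ln_div)
      also have "\<dots> \<le> w\<^sup>2"
        using \<open>2 < w\<close> by (simp add: power2_eq_square)
      finally have "real n \<le> w\<^sup>2"
        using \<open>real n \<le> - ln s\<close> by linarith
      then have "ln (real n) \<le> ln (w\<^sup>2)"
        using \<open>1 \<le> n\<close> \<open>2 < w\<close> by (subst ln_le_cancel_iff) auto
      then have "ln (real n) \<le> 2 * ln w"
        using \<open>2 < w\<close> by (simp add: ln_realpow)
      then show "sqrt (ln (real n)) \<le> sqrt 2 * sqrt (ln w)"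
        by (simp add: real_sqrt_mult [symmetric])
      have "exp (- real n) \<le> exp (1 + ln s)"
        using \<open>- ln s < real n + 1\<close> by simp
      also have "\<dots> = exp 1 * t * u"
        using \<open>0 < s\<close> by (simp add: exp_add s_def)
      finally have "exp (- real n) powr H \<le> (exp 1 * t * u) powr H"
        using \<open>0 \<le> H\<close> by (intro powr_mono2) auto
      then show "exp (- real n) powr H \<le> (exp 1 * t) powr H * u powr H"
        using u \<open>0 < t\<close> by (simp add: powr_mult)
    qed (use \<open>0 \<le> K\<close> \<open>2 < w\<close> in auto)
    also have "\<dots> = C * (u powr H * sqrt (ln w))"
      by (simp add: C_def)
    finally have "\<bar>f s\<bar> \<le> C * (u powr H * sqrt (ln w))" .
    moreover have "0 < u powr H * sqrt (ln w)"
      using u \<open>2 < w\<close> by simp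
    ultimately show ?thesis
      unfolding F_def s_def [symmetric] w_def [symmetric] by (simp add: pos_divide_le_eq)
  qed
  have ev: "\<forall>\<^sub>F u in at_right 0. 0 \<le> F u \<and> F u \<le> C"
    using * \<open>0 < \<delta>\<close> by (auto simp: eventually_at_right_field)
  have "Limsup (at_right 0) (\<lambda>u. ereal (F u)) \<le> ereal C"
    by (rule Limsup_bounded) (use ev in \<open>auto elim: eventually_mono\<close>)
  \<comment> \<open>The lower bound excludes the value minus infinity; it passes through the lower
    limit because the filter is nontrivial.\<close>
  moreover have "ereal 0 \<le> Limsup (at_right 0) (\<lambda>u. ereal (F u))"
  proof -
    have "ereal 0 \<le> Liminf (at_right 0) (\<lambda>u. ereal (F u))"
      by (rule Liminf_bounded) (use ev in \<open>auto elim: eventually_mono\<close>)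
    also have "\<dots> \<le> Limsup (at_right 0) (\<lambda>u. ereal (F u))"
      by (rule Liminf_le_Limsup) (rule trivial_limit_at_right_real)
    finally show ?thesis .
  qed
  ultimately show ?thesis
    unfolding F_def [symmetric] by (cases "Limsup (at_right 0) (\<lambda>u. ereal (F u))") auto
qed

text \<open>Equal laws give equal probabilities for events of the product sigma-algebra. This
  carries statements about one or two times from the integrals to \<open>X\<close>, although the two
  live on different spaces.\<close>

lemma measure_process_law:
  assumes X: "\<And>t. 0 \<le> t \<Longrightarrow> X t \<in> borel_measurable M"
    and Q: "{f \<in> space (\<Pi>\<^sub>M t\<in>{0..}. borel). Q f} \<in> sets (\<Pi>\<^sub>M t\<in>{0..}. borel)"
  shows "measure (process_law M X) {f \<in> space (\<Pi>\<^sub>M t\<in>{0..}. borel). Q f}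
    = measure M {\<omega> \<in> space M. Q (\<lambda>t\<in>{0..}. X t \<omega>)}"
proof -
  have m: "(\<lambda>\<omega>. \<lambda>t\<in>{0..}. X t \<omega>) \<in> measurable M (\<Pi>\<^sub>M t\<in>{0..}. borel)"
    using X by (intro measurable_restrict) auto
  show ?thesis
    unfolding process_law_def measure_distr [OF m Q]
    by (rule arg_cong [where f = "measure M"]) (auto simp: space_PiM)
qed

lemma gfbm_increment_tail:
  assumes "0 \<le> \<gamma>" "\<gamma> < 1" "0 < \<alpha>" "\<alpha> < 1 / 2 + \<gamma> / 2" and gfbm: "is_gfbm \<alpha> \<gamma> M X N W"
  obtains B where "0 < B"
    "\<And>s t R x. 0 \<le> s \<Longrightarrow> s < t \<Longrightarrow> t \<le> R \<Longrightarrow> 0 < x \<Longrightarrow>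
      measure M {\<omega> \<in> space M. B * x * ((t - s) powr \<alpha> * R powr ((1 - \<gamma>) / 2)) \<le> \<bar>X t \<omega> - X s \<omega>\<bar>}
        \<le> 2 * exp (- x\<^sup>2)"
    "AE \<omega> in M. X 0 \<omega> = 0"
proof -
  interpret M: prob_space M using gfbm by (simp add: is_gfbm_def)
  interpret G: gaussian_random_measure N lborel W using gfbm by (simp add: is_gfbm_def)
  obtain I where I: "\<And>t. 0 \<le> t \<Longrightarrow> has_wiener_integral N lborel W (gfbm_kernel \<alpha> \<gamma> t) (I t)"
    and law: "process_law M X = process_law N (\<lambda>t \<omega>. gfbm_const \<alpha> \<gamma> * I t \<omega>)"
    using gfbm by (auto simp: is_gfbm_def)
  define c where "c = gfbm_const \<alpha> \<gamma>"
  have X: "X t \<in> borel_measurable M" if "0 \<le> t" for t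
    using gfbm that by (simp add: is_gfbm_def)
  have Im: "I t \<in> borel_measurable N" if "0 \<le> t" for t
    using I [OF that] by (simp add: has_wiener_integral_def)
  have transfer: "M.prob {\<omega> \<in> space M. Q (\<lambda>t\<in>{0..}. X t \<omega>)}
      = G.prob {\<omega> \<in> space N. Q (\<lambda>t\<in>{0..}. c * I t \<omega>)}"
    if "{f \<in> space (\<Pi>\<^sub>M t\<in>{0::real..}. borel). Q f} \<in> sets (\<Pi>\<^sub>M t\<in>{0..}. borel)"
    for Q :: "(real \<Rightarrow> real) \<Rightarrow> bool"
    using measure_process_law [OF X that, of "\<lambda>t. t"] measure_process_law [of "\<lambda>t \<omega>. c * I t \<omega>" N Q, OF _ that] Im
    by (simp add: law c_def)
  define C where "C = 2 / (1 - \<gamma>) + 1 / (1 + \<gamma> - 2 * \<alpha>)"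
  have "0 < C" using assms by (auto simp: C_def intro!: add_pos_pos)
  \<comment> \<open>The 2 and the 12 are those of \<open>prob_wiener_integral_diff_le\<close>;
    \<open>\<bar>c\<bar> + 1\<close> keeps \<open>B\<close> positive whatever the value of
    \<open>c\<close>.\<close>
  define B where "B = 2 * sqrt (12 * C) * (\<bar>c\<bar> + 1)"
  show thesis
  proof
    show "0 < B" using \<open>0 < C\<close> by (simp add: B_def add_nonneg_pos)
    fix s t R x :: real
    assume st: "0 \<le> s" "s < t" "t \<le> R" and "0 < x"
    have comp [measurable]: "(\<lambda>f. f r) \<in> borel_measurable (\<Pi>\<^sub>M t\<in>{0::real..}. (borel :: real measure))" if "0 \<le> r" for r :: real
      using that by (intro measurable_component_singleton) simp
    define V where "V = C * ((t - s) powr (2 * \<alpha>) * R powr (1 - \<gamma>))"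
    \<comment> \<open>Normalised so that the exponent \<open>z\<^sup>2 / (12 * V)\<close> is exactly
      \<open>x\<^sup>2\<close>.\<close>
    define z where "z = x * sqrt (12 * V)"
    have "0 < V" using \<open>0 < C\<close> st by (simp add: V_def)
    then have "0 < z" using \<open>0 < x\<close> by (simp add: z_def)
    have "sqrt (12 * V) = sqrt (12 * C) * ((t - s) powr \<alpha> * R powr ((1 - \<gamma>) / 2))"
    proof (rule real_sqrt_unique)
      have "((t - s) powr \<alpha>)\<^sup>2 = (t - s) powr (2 * \<alpha>)" "(R powr ((1 - \<gamma>) / 2))\<^sup>2 = R powr (1 - \<gamma>)"
        by (simp_all add: power2_eq_square powr_add [symmetric])
      then show "(sqrt (12 * C) * ((t - s) powr \<alpha> * R powr ((1 - \<gamma>) / 2)))\<^sup>2 = 12 * V"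
        using \<open>0 < C\<close> by (simp add: V_def power_mult_distrib)
    qed (use \<open>0 < C\<close> in simp)
    then have Bz: "B * x * ((t - s) powr \<alpha> * R powr ((1 - \<gamma>) / 2)) = 2 * z * (\<bar>c\<bar> + 1)"
      by (simp add: B_def z_def)
    have "M.prob {\<omega> \<in> space M. 2 * z * (\<bar>c\<bar> + 1) \<le> \<bar>X t \<omega> - X s \<omega>\<bar>}
        = G.prob {\<omega> \<in> space N. 2 * z * (\<bar>c\<bar> + 1) \<le> \<bar>c * I t \<omega> - c * I s \<omega>\<bar>}"
      using transfer [of "\<lambda>f. 2 * z * (\<bar>c\<bar> + 1) \<le> \<bar>f t - f s\<bar>"] st by simp
    also have "\<dots> \<le> G.prob {\<omega> \<in> space N. 2 * z \<le> \<bar>I t \<omega> - I s \<omega>\<bar>}"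
    proof (rule G.finite_measure_mono)
      show "{\<omega> \<in> space N. 2 * z * (\<bar>c\<bar> + 1) \<le> \<bar>c * I t \<omega> - c * I s \<omega>\<bar>}
          \<subseteq> {\<omega> \<in> space N. 2 * z \<le> \<bar>I t \<omega> - I s \<omega>\<bar>}"
      proof clarsimp
        fix \<omega>
        assume "2 * z * (\<bar>c\<bar> + 1) \<le> \<bar>c * I t \<omega> - c * I s \<omega>\<bar>"
        also have "\<dots> = \<bar>I t \<omega> - I s \<omega>\<bar> * \<bar>c\<bar>"
          by (simp add: right_diff_distrib [symmetric] abs_mult)
        also have "\<dots> \<le> \<bar>I t \<omega> - I s \<omega>\<bar> * (\<bar>c\<bar> + 1)"
          by (intro mult_left_mono) auto
        finally show "2 * z \<le> \<bar>I t \<omega> - I s \<omega>\<bar>"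
          by (simp add: mult_le_cancel_right)
      qed
      have "I t \<in> borel_measurable N" "I s \<in> borel_measurable N"
        using Im st by auto
      then show "{\<omega> \<in> space N. 2 * z \<le> \<bar>I t \<omega> - I s \<omega>\<bar>} \<in> sets N"
        by measurable
    qed
    also have "\<dots> \<le> 2 * exp (- z\<^sup>2 / (12 * V))"
    proof (rule G.prob_wiener_integral_diff_le [OF I I])
      show "(\<integral>\<^sup>+ u. ennreal ((gfbm_kernel \<alpha> \<gamma> t u - gfbm_kernel \<alpha> \<gamma> s u)\<^sup>2) \<partial>lborel) \<le> ennreal V"
        unfolding V_def C_def using assms st by (intro nn_integral_gfbm_kernel_diff_le) auto
    qed (use st \<open>0 < V\<close> \<open>0 < z\<close> in auto)
    also have "- z\<^sup>2 / (12 * V) = - x\<^sup>2"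
      using \<open>0 < V\<close> by (simp add: z_def power_mult_distrib)
    finally show "M.prob {\<omega> \<in> space M. B * x * ((t - s) powr \<alpha> * R powr ((1 - \<gamma>) / 2)) \<le> \<bar>X t \<omega> - X s \<omega>\<bar>}
        \<le> 2 * exp (- x\<^sup>2)"
      by (simp add: Bz)
  next
    have [measurable]: "I 0 \<in> borel_measurable N" by (simp add: Im)
    have "G.prob {\<omega> \<in> space N. 2 * x \<le> \<bar>I 0 \<omega>\<bar>} \<le> 0" if "0 < x" for x
    proof (rule field_le_epsilon)
      fix \<epsilon> :: real
      assume "0 < \<epsilon>"
      \<comment> \<open>The kernel at time 0 is zero, so any positive \<open>V\<close> bounds its
        distance to 0. This one makes the exponent \<open>- (2 / \<epsilon>)\<close>, and
        \<open>2 * exp (- (2 / \<epsilon>)) \<le> \<epsilon>\<close>.\<close>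
      define V where "V = \<epsilon> * x\<^sup>2 / 24"
      have "0 < V" using \<open>0 < x\<close> \<open>0 < \<epsilon>\<close> by (simp add: V_def)
      have "G.prob {\<omega> \<in> space N. 2 * x \<le> \<bar>I 0 \<omega> - 0\<bar>} \<le> 2 * exp (- x\<^sup>2 / (12 * V))"
        using I [of 0] \<open>0 < V\<close> \<open>0 < x\<close>
        by (intro G.prob_wiener_integral_diff_le [OF _ G.has_wiener_integral_zero]) (auto simp: gfbm_kernel_zero)
      also have "- x\<^sup>2 / (12 * V) = - (2 / \<epsilon>)"
        using \<open>0 < x\<close> by (simp add: V_def)
      also have "2 * exp (- (2 / \<epsilon>)) \<le> \<epsilon>"
      proof -
        have "2 / \<epsilon> \<le> exp (2 / \<epsilon>)"
          using exp_ge_add_one_self [of "2 / \<epsilon>"] by linarith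
        then show ?thesis
          using \<open>0 < \<epsilon>\<close> by (simp add: exp_minus field_simps)
      qed
      finally show "G.prob {\<omega> \<in> space N. 2 * x \<le> \<bar>I 0 \<omega>\<bar>} \<le> 0 + \<epsilon>" by simp
    qed
    then have "G.prob {\<omega> \<in> space N. 2 * x \<le> \<bar>I 0 \<omega>\<bar>} = 0" if "0 < x" for x
      using that by (intro antisym) auto
    then have small: "AE \<omega> in N. \<not> 2 * x \<le> \<bar>I 0 \<omega>\<bar>" if "0 < x" for x
      using that by (subst AE_iff_measurable [OF _ refl]) (auto simp: G.emeasure_eq_measure)
    have "AE \<omega> in N. \<forall>n::nat. \<not> 2 * (1 / real (Suc n)) \<le> \<bar>I 0 \<omega>\<bar>"
      unfolding AE_all_countable by (intro allI small) simp
    then have "AE \<omega> in N. c * I 0 \<omega> = 0"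
    proof eventually_elim
      case (elim \<omega>)
      show ?case
      proof (rule ccontr)
        assume "c * I 0 \<omega> \<noteq> 0"
        then have "0 < \<bar>I 0 \<omega>\<bar> / 2" by simp
        then obtain n where "inverse (real (Suc n)) < \<bar>I 0 \<omega>\<bar> / 2"
          using reals_Archimedean by blast
        then show False
          using elim [rule_format, of n] by (simp add: inverse_eq_divide)
      qed
    qed
    then have "G.prob {\<omega> \<in> space N. c * I 0 \<omega> \<noteq> 0} = 0"
      by (subst (asm) AE_iff_measurable [OF _ refl]) (auto simp: G.emeasure_eq_measure)
    moreover have "{f \<in> space (\<Pi>\<^sub>M t\<in>{0::real..}. (borel :: real measure)). f 0 \<noteq> 0} \<in> sets (\<Pi>\<^sub>M t\<in>{0..}. borel)"
    proof -
      have [measurable]: "(\<lambda>f. f 0) \<in> borel_measurable (\<Pi>\<^sub>M t\<in>{0::real..}. (borel :: real measure))"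
        by (intro measurable_component_singleton) simp
      show ?thesis by measurable
    qed
    ultimately have "M.prob {\<omega> \<in> space M. X 0 \<omega> \<noteq> 0} = 0"
      using transfer [of "\<lambda>f. f 0 \<noteq> 0"] by simp
    then show "AE \<omega> in M. X 0 \<omega> = 0"
      using X [of 0] by (subst AE_iff_measurable [OF _ refl]) (auto simp: M.emeasure_eq_measure)
  qed
qed

theorem theorem6p1:
  fixes T \<alpha> \<gamma> H :: real
    and M :: "'a measure" and X :: "real \<Rightarrow> 'a \<Rightarrow> real"
    and N :: "'b measure" and W :: "real set \<Rightarrow> 'b \<Rightarrow> real"
  assumes "T > 0"
    and "0 \<le> \<gamma>" and "\<gamma> < 1"
    and "- 1 / 2 + \<gamma> / 2 < \<alpha>" and "\<alpha> < 1 / 2 + \<gamma> / 2"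
    and "H = \<alpha> - \<gamma> / 2 + 1 / 2"
    and "is_gfbm \<alpha> \<gamma> M X N W"
    and "\<alpha> > 0"
  shows "AE \<omega> in M. \<forall>t\<in>{0<..T}. \<exists>L::real.
    Limsup (at_right 0)
      (\<lambda>u. ereal (\<bar>X (u * t) \<omega>\<bar> / (u powr H * sqrt (ln (ln (1 / u)))))) = ereal L"
proof -
  interpret M: prob_space M using assms by (simp add: is_gfbm_def)
  \<comment> \<open>The chaining exponent of the lag and the exponent of the block length add up to
    the self-similarity index.\<close>
  have H: "0 \<le> H" "\<alpha> + (1 - \<gamma>) / 2 = H" using assms by (simp_all add: field_simps)
  obtain B where "0 < B" and tail: "\<And>s t R x. 0 \<le> s \<Longrightarrow> s < t \<Longrightarrow> t \<le> R \<Longrightarrow> 0 < x \<Longrightarrow>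
      M.prob {\<omega> \<in> space M. B * x * ((t - s) powr \<alpha> * R powr ((1 - \<gamma>) / 2)) \<le> \<bar>X t \<omega> - X s \<omega>\<bar>}
        \<le> 2 * exp (- x\<^sup>2)"
    and X0: "AE \<omega> in M. X 0 \<omega> = 0"
    using gfbm_increment_tail assms by blast
  have X: "X t \<in> borel_measurable M" if "0 \<le> t" for t
    using assms that by (simp add: is_gfbm_def)
  have cont: "continuous_on {0..} (\<lambda>t. X t \<omega>)" if "\<omega> \<in> space M" for \<omega>
    using assms that by (simp add: is_gfbm_def)
  obtain K where "0 \<le> K" and K: "AE \<omega> in M. \<forall>\<^sub>F n in sequentially. \<forall>t\<in>{0..exp (- real n)}.
       \<bar>X t \<omega> - X 0 \<omega>\<bar> \<le> K * (sqrt (ln (real n)) * exp (- real n) powr H)"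
    using M.AE_bound_near_0 [OF X cont \<open>\<alpha> > 0\<close> \<open>0 < B\<close> tail] unfolding H(2) by blast
  from K X0 show ?thesis
  proof eventually_elim
    case (elim \<omega>)
    then show ?case
      using \<open>0 \<le> K\<close> H(1) by (auto intro!: Limsup_iterated_log_finite [where K = K])
  qed
qed

end
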